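(* Let $G$ and $H$ be multi-conclusion sequent calculi such that $H$ extends $\mathbf{CFL_e}$. Suppose $H$ is an axiomatic extension of $G$ by multi-conclusion semi-analytic rules, and if $H$ also has the modal rule $4$ or $4D$, then the left weakening rule for boxed formulas ($\Gamma\Rightarrow\Delta/\Gamma,\Box\phi\Rightarrow\Delta$) is admissible in $H$. Then if $G$ has strong $H$-interpolation (resp. strong $H$-feasible interpolation), so does $H$.
   Context: Formulas in a fixed propositional language containing $\wedge,\vee,\to,*,+,0,1,\top,\bot$ and possibly $\Box$; $V(\cdot)$: atoms (for meta-formulas also formula variables). Sequents $\Gamma\Rightarrow\Delta$ with finite multisets. Rules: schemes over meta-formulas and meta-multiset variables. $\mathbf{CFL_e}$: multi-conclusion calculus with axioms $\phi\Rightarrow\phi$, $\Rightarrow1$, $0\Rightarrow$, $\Gamma\Rightarrow\top,\Delta$, $\Gamma,\bot\Rightarrow\Delta$ and the standard multi-conclusion rules for $1,0,\wedge,\vee,*,\to,+$ (e.g. $\Gamma\Rightarrow\phi,\Delta\ \ \Sigma\Rightarrow\psi,\Lambda/\Gamma,\Sigma\Rightarrow\phi*\psi,\Delta,\Lambda$; $\Gamma\Rightarrow\phi,\Delta\ \ \Sigma,\psi\Rightarrow\Lambda/\Gamma,\Sigma,\phi\to\psi\Rightarrow\Delta,\Lambda$; $\Gamma,\phi\Rightarrow\Delta\ \ \Sigma,\psi\Rightarrow\Lambda/\Gamma,\Sigma,\phi+\psi\Rightarrow\Delta,\Lambda$; $\Gamma\Rightarrow\phi,\psi,\Delta/\Gamma\Rightarrow\phi+\psi,\Delta$).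 $H$ extends $\mathbf{CFL_e}$: every $\mathbf{CFL_e}$-provable sequent is $H$-provable. Axiomatic extension of $G$ by rules $R$: all $G$-provable sequents as axioms plus the rules $R$. Multi-conclusion semi-analytic rules: left: premises $\Gamma_i,\bar\phi_{ir}\Rightarrow\bar\psi_{ir},\Delta_i$, conclusion $\Gamma_1,\dots,\Gamma_n,\phi\Rightarrow\Delta_1,\dots,\Delta_n$; right: same premises, conclusion $\Gamma_1,\dots,\Gamma_n\Rightarrow\phi,\Delta_1,\dots,\Delta_n$; $\Gamma_i,\Delta_i$ meta-multiset variables and all variables of $\bar\phi_{ir},\bar\psi_{ir}$ in $V(\phi)$; modal: $K$: $\Gamma\Rightarrow\phi/\Box\Gamma\Rightarrow\Box\phi$, $D$: $\Gamma\Rightarrow/\Box\Gamma\Rightarrow$ (only with $K$), $RS4$: $\Box\Gamma\Rightarrow\phi/\Box\Gamma\Rightarrow\Box\phi$ (only with $LS4$: $\Gamma,\phi\Rightarrow\Delta/\Gamma,\Box\phi\Rightarrow\Delta$). Rule $4$: $\Box\Gamma,\Gamma\Rightarrow\phi/\Box\Gamma\Rightarrow\Box\phi$; $4D$: $\Box\Gamma,\Gamma\Rightarrow/\Box\Gamma\Rightarrow$ (only with $4$). $G$ has strong $H$-interpolation if whenever $\Sigma,\Lambda\Rightarrow\Theta,\Delta$ has a tree-like $G$-proof $\pi$ there is $C$ with $H\vdash\Sigma\Rightarrow C,\Theta$, $H\vdash\Lambda,C\Rightarrow\Delta$ and $V(C)\subseteq V(\Sigma\cup\Theta)\cap V(\Lambda\cup\Delta)$;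 strong $H$-feasible interpolation additionally requires $|C|\le|\pi|^{O(1)}$.
   Formalization: "H extends CFL_e" is read as: all axioms and rules of CFL_e are admissible in H (mere inclusion of provable sequents makes the claim false); and the size of an H-proof counts the G-proofs of the G-provable sequents used as axioms. *)

theory Defs
  imports Main "HOL-Library.Multiset"
begin

text \<open>
  A language always contains the constants and connectives of CFLe; it may contain the box, and
  any further connectives (the domain of \<open>arity\<close>). \<open>Op\<close> applies such a further connective.
  The set function \<open>vars\<close> is the paper's V.
\<close>

datatype 'c lang = Lang (has_box: bool) (arity: "'c \<Rightarrow> nat option")

datatype (vars: 'a, conns: 'c) fm =
    Atom 'a | Zero | One | Top | Bot
  | And "('a, 'c) fm" "('a, 'c) fm"
  | Or "('a, 'c) fm" "('a, 'c) fm"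
  | Imp "('a, 'c) fm" "('a, 'c) fm"
  | Times "('a, 'c) fm" "('a, 'c) fm"
  | Plus "('a, 'c) fm" "('a, 'c) fm"
  | Box "('a, 'c) fm"
  | Op 'c "('a, 'c) fm list"

fun form :: "'c lang \<Rightarrow> ('a, 'c) fm \<Rightarrow> bool" where
  "form L (Atom a) = True"
| "form L Zero = True"
| "form L One = True"
| "form L Top = True"
| "form L Bot = True"
| "form L (And \<phi> \<psi>) = (form L \<phi> \<and> form L \<psi>)"
| "form L (Or \<phi> \<psi>) = (form L \<phi> \<and> form L \<psi>)"
| "form L (Imp \<phi> \<psi>) = (form L \<phi> \<and> form L \<psi>)"
| "form L (Times \<phi> \<psi>) = (form L \<phi> \<and> form L \<psi>)"
| "form L (Plus \<phi> \<psi>) = (form L \<phi> \<and> form L \<psi>)"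
| "form L (Box \<phi>) = (has_box L \<and> form L \<phi>)"
| "form L (Op c \<phi>s) = (arity L c = Some (length \<phi>s) \<and> (\<forall>\<phi>\<in>set \<phi>s. form L \<phi>))"

fun fsize :: "('a, 'c) fm \<Rightarrow> nat" where
  "fsize (Atom a) = 1"
| "fsize Zero = 1"
| "fsize One = 1"
| "fsize Top = 1"
| "fsize Bot = 1"
| "fsize (And \<phi> \<psi>) = fsize \<phi> + fsize \<psi> + 1"
| "fsize (Or \<phi> \<psi>) = fsize \<phi> + fsize \<psi> + 1"
| "fsize (Imp \<phi> \<psi>) = fsize \<phi> + fsize \<psi> + 1"
| "fsize (Times \<phi> \<psi>) = fsize \<phi> + fsize \<psi> + 1"
| "fsize (Plus \<phi> \<psi>) = fsize \<phi> + fsize \<psi> + 1"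
| "fsize (Box \<phi>) = fsize \<phi> + 1"
| "fsize (Op c \<phi>s) = sum_list (map fsize \<phi>s) + 1"

fun subst :: "('a \<Rightarrow> ('b, 'c) fm) \<Rightarrow> ('a, 'c) fm \<Rightarrow> ('b, 'c) fm" where
  "subst s (Atom a) = s a"
| "subst s Zero = Zero"
| "subst s One = One"
| "subst s Top = Top"
| "subst s Bot = Bot"
| "subst s (And \<phi> \<psi>) = And (subst s \<phi>) (subst s \<psi>)"
| "subst s (Or \<phi> \<psi>) = Or (subst s \<phi>) (subst s \<psi>)"
| "subst s (Imp \<phi> \<psi>) = Imp (subst s \<phi>) (subst s \<psi>)"
| "subst s (Times \<phi> \<psi>) = Times (subst s \<phi>) (subst s \<psi>)"
| "subst s (Plus \<phi> \<psi>) = Plus (subst s \<phi>) (subst s \<psi>)"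
| "subst s (Box \<phi>) = Box (subst s \<phi>)"
| "subst s (Op c \<phi>s) = Op c (map (subst s) \<phi>s)"

type_synonym ('a, 'c) seq = "('a, 'c) fm multiset \<times> ('a, 'c) fm multiset"

definition form_mset :: "'c lang \<Rightarrow> ('a, 'c) fm multiset \<Rightarrow> bool" where
  "form_mset L \<Gamma> \<longleftrightarrow> (\<forall>\<phi>\<in>#\<Gamma>. form L \<phi>)"

definition vars_mset :: "('a, 'c) fm multiset \<Rightarrow> 'a set" where
  "vars_mset \<Gamma> = (\<Union>\<phi>\<in>set_mset \<Gamma>. vars \<phi>)"

text \<open>
  A meta-formula is a formula over atoms and formula variables, so that \<open>vars\<close> of a
  meta-formula collects both. A side of a meta-sequent is a multiset of meta-formulas,
  meta-multiset variables \<open>\<Gamma>\<close> (\<open>MVar\<close>) and boxed ones \<open>\<box>\<Gamma>\<close> (\<open>MBox\<close>).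
\<close>

datatype 'a matom = PAtom 'a | FVar nat

type_synonym ('a, 'c) mfm = "('a matom, 'c) fm"

datatype ('a, 'c) mitem = MFm "('a, 'c) mfm" | MVar nat | MBox nat

type_synonym ('a, 'c) mseq = "('a, 'c) mitem multiset \<times> ('a, 'c) mitem multiset"

type_synonym ('a, 'c) rule = "('a, 'c) mseq multiset \<times> ('a, 'c) mseq"

fun item_ok :: "'c lang \<Rightarrow> ('a, 'c) mitem \<Rightarrow> bool" where
  "item_ok L (MFm \<phi>) = form L \<phi>"
| "item_ok L (MVar m) = True"
| "item_ok L (MBox m) = has_box L"

definition mseq_ok :: "'c lang \<Rightarrow> ('a, 'c) mseq \<Rightarrow> bool" where
  "mseq_ok L S \<longleftrightarrow> (\<forall>x\<in>#fst S + snd S. item_ok L x)"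

definition calculus :: "'c lang \<Rightarrow> ('a, 'c) rule set \<Rightarrow> bool" where
  "calculus L R \<longleftrightarrow> (\<forall>(Ps, S)\<in>R. mseq_ok L S \<and> (\<forall>P\<in>#Ps. mseq_ok L P))"

definition inst_fm :: "(nat \<Rightarrow> ('a, 'c) fm) \<Rightarrow> ('a, 'c) mfm \<Rightarrow> ('a, 'c) fm" where
  "inst_fm \<sigma> = subst (case_matom Atom \<sigma>)"

fun inst_item ::
  "(nat \<Rightarrow> ('a, 'c) fm) \<Rightarrow> (nat \<Rightarrow> ('a, 'c) fm multiset) \<Rightarrow> ('a, 'c) mitem \<Rightarrow> ('a, 'c) fm multiset"
where
  "inst_item \<sigma> \<tau> (MFm \<phi>) = {#inst_fm \<sigma> \<phi>#}"
| "inst_item \<sigma> \<tau> (MVar m) = \<tau> m"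
| "inst_item \<sigma> \<tau> (MBox m) = image_mset Box (\<tau> m)"

definition inst_seq ::
  "(nat \<Rightarrow> ('a, 'c) fm) \<Rightarrow> (nat \<Rightarrow> ('a, 'c) fm multiset) \<Rightarrow> ('a, 'c) mseq \<Rightarrow> ('a, 'c) seq"
where
  "inst_seq \<sigma> \<tau> S =
     (sum_mset (image_mset (inst_item \<sigma> \<tau>) (fst S)), sum_mset (image_mset (inst_item \<sigma> \<tau>) (snd S)))"

definition rule_instance ::
  "'c lang \<Rightarrow> ('a, 'c) rule \<Rightarrow> ('a, 'c) seq multiset \<Rightarrow> ('a, 'c) seq \<Rightarrow> bool"
where
  "rule_instance L r Ps S \<longleftrightarrow>
     (\<exists>\<sigma> \<tau>. (\<forall>n. form L (\<sigma> n)) \<and> (\<forall>m. form_mset L (\<tau> m)) \<and>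
        Ps = image_mset (inst_seq \<sigma> \<tau>) (fst r) \<and> S = inst_seq \<sigma> \<tau> (snd r))"

datatype ('a, 'c) ptree = Node (concl: "('a, 'c) seq") (subproofs: "('a, 'c) ptree list")

definition seq_size :: "('a, 'c) seq \<Rightarrow> nat" where
  "seq_size S = sum_mset (image_mset fsize (fst S)) + sum_mset (image_mset fsize (snd S)) + 1"

fun psize :: "('a, 'c) ptree \<Rightarrow> nat" where
  "psize (Node S \<pi>s) = seq_size S + sum_list (map psize \<pi>s)"

text \<open>
  The axiomatic extension, by rules \<open>R\<close>, of a system whose proofs are the trees in \<open>B\<close>:
  the sequents proved by \<open>B\<close> serve as axioms, to which only the rules of \<open>R\<close> are applied.
  A leaf carries its proof in \<open>B\<close>, and this proof counts for the size of the whole. If only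
  the end-sequent of the \<open>B\<close>-proof were counted, feasible interpolation of \<open>B\<close> would give no bound
  for the interpolants of the axioms.
\<close>

inductive_set ax_ext ::
  "'c lang \<Rightarrow> ('a, 'c) ptree set \<Rightarrow> ('a, 'c) rule set \<Rightarrow> ('a, 'c) ptree set"
  for L :: "'c lang" and B :: "('a, 'c) ptree set" and R :: "('a, 'c) rule set"
where
  base: "\<pi> \<in> B \<Longrightarrow> \<pi> \<in> ax_ext L B R"
| step: "r \<in> R \<Longrightarrow> rule_instance L r (mset (map concl \<pi>s)) S \<Longrightarrow> (\<And>\<pi>. \<pi> \<in> set \<pi>s \<Longrightarrow> \<pi> \<in> ax_ext L B R)
    \<Longrightarrow> Node S \<pi>s \<in> ax_ext L B R"

definition proofs :: "'c lang \<Rightarrow> ('a, 'c) rule set \<Rightarrow> ('a, 'c) ptree set" where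
  "proofs L G = ax_ext L {} G"

definition provable :: "('a, 'c) ptree set \<Rightarrow> ('a, 'c) seq set" where
  "provable P = concl ` P"

abbreviation "mF n \<equiv> MFm (Atom (FVar n))"

definition CFLe :: "('a, 'c) rule set" where
  "CFLe =
   (let p = Atom (FVar 0); q = Atom (FVar 1); \<phi> = mF 0; \<psi> = mF 1;
        \<Gamma> = MVar 0; \<Delta> = MVar 1; \<Sigma> = MVar 2; \<Lambda> = MVar 3
    in {
      ({#}, ({#\<phi>#}, {#\<phi>#})),
      ({#}, ({#}, {#MFm One#})),
      ({#}, ({#MFm Zero#}, {#})),
      ({#}, ({#\<Gamma>#}, {#MFm Top, \<Delta>#})),
      ({#}, ({#\<Gamma>, MFm Bot#}, {#\<Delta>#})),
      ({#({#\<Gamma>#}, {#\<Delta>#})#}, ({#\<Gamma>, MFm One#}, {#\<Delta>#})),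
      ({#({#\<Gamma>#}, {#\<Delta>#})#}, ({#\<Gamma>#}, {#MFm Zero, \<Delta>#})),
      ({#({#\<Gamma>, \<phi>#}, {#\<Delta>#})#}, ({#\<Gamma>, MFm (And p q)#}, {#\<Delta>#})),
      ({#({#\<Gamma>, \<psi>#}, {#\<Delta>#})#}, ({#\<Gamma>, MFm (And p q)#}, {#\<Delta>#})),
      ({#({#\<Gamma>#}, {#\<phi>, \<Delta>#}), ({#\<Gamma>#}, {#\<psi>, \<Delta>#})#}, ({#\<Gamma>#}, {#MFm (And p q), \<Delta>#})),
      ({#({#\<Gamma>, \<phi>#}, {#\<Delta>#}), ({#\<Gamma>, \<psi>#}, {#\<Delta>#})#}, ({#\<Gamma>, MFm (Or p q)#}, {#\<Delta>#})),
      ({#({#\<Gamma>#}, {#\<phi>, \<Delta>#})#}, ({#\<Gamma>#}, {#MFm (Or p q), \<Delta>#})),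
      ({#({#\<Gamma>#}, {#\<psi>, \<Delta>#})#}, ({#\<Gamma>#}, {#MFm (Or p q), \<Delta>#})),
      ({#({#\<Gamma>, \<phi>, \<psi>#}, {#\<Delta>#})#}, ({#\<Gamma>, MFm (Times p q)#}, {#\<Delta>#})),
      ({#({#\<Gamma>#}, {#\<phi>, \<Delta>#}), ({#\<Sigma>#}, {#\<psi>, \<Lambda>#})#}, ({#\<Gamma>, \<Sigma>#}, {#MFm (Times p q), \<Delta>, \<Lambda>#})),
      ({#({#\<Gamma>#}, {#\<phi>, \<Delta>#}), ({#\<Sigma>, \<psi>#}, {#\<Lambda>#})#}, ({#\<Gamma>, \<Sigma>, MFm (Imp p q)#}, {#\<Delta>, \<Lambda>#})),
      ({#({#\<Gamma>, \<phi>#}, {#\<psi>, \<Delta>#})#}, ({#\<Gamma>#}, {#MFm (Imp p q), \<Delta>#})),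
      ({#({#\<Gamma>, \<phi>#}, {#\<Delta>#}), ({#\<Sigma>, \<psi>#}, {#\<Lambda>#})#}, ({#\<Gamma>, \<Sigma>, MFm (Plus p q)#}, {#\<Delta>, \<Lambda>#})),
      ({#({#\<Gamma>#}, {#\<phi>, \<psi>, \<Delta>#})#}, ({#\<Gamma>#}, {#MFm (Plus p q), \<Delta>#}))
    })"

text \<open>
  Adding CFLe on top of \<open>H\<close> proves nothing new; equivalently, all axioms and rules of CFLe are
  admissible in \<open>H\<close>. In particular every CFLe-provable sequent is \<open>H\<close>-provable. The bare inclusion
  of provable sequents would say nothing about closure of \<open>H\<close> under the CFLe rules, and with it
  interpolation need not be preserved.
\<close>

definition extends_CFLe :: "'c lang \<Rightarrow> ('a, 'c) ptree set \<Rightarrow> bool" where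
  "extends_CFLe L H \<longleftrightarrow> provable (ax_ext L H CFLe) \<subseteq> provable H"

text \<open>
  \<open>(\<Gamma>\<^sub>i, \<Delta>\<^sub>i, ps\<^sub>i)\<close> stands for the family of premises \<open>\<Gamma>\<^sub>i, \<phi>s \<Rightarrow> \<psi>s, \<Delta>\<^sub>i\<close> with \<open>(\<phi>s, \<psi>s)\<close> ranging over
  the list \<open>ps\<^sub>i\<close> (the index r); the list of all such triples is indexed by i.
\<close>

type_synonym ('a, 'c) family =
  "nat \<times> nat \<times> (('a, 'c) mfm multiset \<times> ('a, 'c) mfm multiset) list"

definition family_prems :: "('a, 'c) family \<Rightarrow> ('a, 'c) mseq list" where
  "family_prems = (\<lambda>(g, d, ps).
     map (\<lambda>(\<phi>s, \<psi>s). (add_mset (MVar g) (image_mset MFm \<phi>s), add_mset (MVar d) (image_mset MFm \<psi>s))) ps)"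

definition sa_prems :: "('a, 'c) family list \<Rightarrow> ('a, 'c) mseq multiset" where
  "sa_prems fs = mset (concat (map family_prems fs))"

definition left_ctx :: "('a, 'c) family list \<Rightarrow> ('a, 'c) mitem multiset" where
  "left_ctx fs = mset (map (\<lambda>(g, d, ps). MVar g) fs)"

definition right_ctx :: "('a, 'c) family list \<Rightarrow> ('a, 'c) mitem multiset" where
  "right_ctx fs = mset (map (\<lambda>(g, d, ps). MVar d) fs)"

definition sa_condition :: "('a, 'c) family list \<Rightarrow> ('a, 'c) mfm \<Rightarrow> bool" where
  "sa_condition fs \<phi> \<longleftrightarrow>
     distinct (map (\<lambda>(g, d, ps). g) fs @ map (\<lambda>(g, d, ps). d) fs) \<and>
     (\<forall>(g, d, ps)\<in>set fs. \<forall>(\<phi>s, \<psi>s)\<in>set ps. \<forall>\<chi>\<in>#\<phi>s + \<psi>s. vars \<chi> \<subseteq> vars \<phi>)"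

definition left_semi_analytic :: "('a, 'c) rule \<Rightarrow> bool" where
  "left_semi_analytic r \<longleftrightarrow>
     (\<exists>fs \<phi>. sa_condition fs \<phi> \<and> r = (sa_prems fs, (add_mset (MFm \<phi>) (left_ctx fs), right_ctx fs)))"

definition right_semi_analytic :: "('a, 'c) rule \<Rightarrow> bool" where
  "right_semi_analytic r \<longleftrightarrow>
     (\<exists>fs \<phi>. sa_condition fs \<phi> \<and> r = (sa_prems fs, (left_ctx fs, add_mset (MFm \<phi>) (right_ctx fs))))"

definition is_K :: "('a, 'c) rule \<Rightarrow> bool" where
  "is_K r \<longleftrightarrow> (\<exists>g p. r = ({#({#MVar g#}, {#mF p#})#}, ({#MBox g#}, {#MFm (Box (Atom (FVar p)))#})))"

definition is_D :: "('a, 'c) rule \<Rightarrow> bool" where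
  "is_D r \<longleftrightarrow> (\<exists>g. r = ({#({#MVar g#}, {#})#}, ({#MBox g#}, {#})))"

definition is_RS4 :: "('a, 'c) rule \<Rightarrow> bool" where
  "is_RS4 r \<longleftrightarrow> (\<exists>g p. r = ({#({#MBox g#}, {#mF p#})#}, ({#MBox g#}, {#MFm (Box (Atom (FVar p)))#})))"

definition is_LS4 :: "('a, 'c) rule \<Rightarrow> bool" where
  "is_LS4 r \<longleftrightarrow> (\<exists>g d p. g \<noteq> d \<and>
     r = ({#({#MVar g, mF p#}, {#MVar d#})#}, ({#MVar g, MFm (Box (Atom (FVar p)))#}, {#MVar d#})))"

definition is_4 :: "('a, 'c) rule \<Rightarrow> bool" where
  "is_4 r \<longleftrightarrow>
     (\<exists>g p. r = ({#({#MBox g, MVar g#}, {#mF p#})#}, ({#MBox g#}, {#MFm (Box (Atom (FVar p)))#})))"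

definition is_4D :: "('a, 'c) rule \<Rightarrow> bool" where
  "is_4D r \<longleftrightarrow> (\<exists>g. r = ({#({#MBox g, MVar g#}, {#})#}, ({#MBox g#}, {#})))"

definition semi_analytic :: "('a, 'c) rule \<Rightarrow> bool" where
  "semi_analytic r \<longleftrightarrow>
     left_semi_analytic r \<or> right_semi_analytic r \<or> is_K r \<or> is_D r \<or> is_RS4 r"

definition modal_provisos :: "('a, 'c) rule set \<Rightarrow> bool" where
  "modal_provisos R \<longleftrightarrow>
     ((\<exists>r\<in>R. is_D r) \<longrightarrow> (\<exists>r\<in>R. is_K r)) \<and>
     ((\<exists>r\<in>R. is_RS4 r) \<longrightarrow> (\<exists>r\<in>R. is_LS4 r)) \<and>
     ((\<exists>r\<in>R. is_4D r) \<longrightarrow> (\<exists>r\<in>R. is_4 r))"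

definition box_weakening_admissible :: "'c lang \<Rightarrow> ('a, 'c) ptree set \<Rightarrow> bool" where
  "box_weakening_admissible L H \<longleftrightarrow>
     (\<forall>\<Gamma> \<Delta> \<phi>. form L (Box \<phi>) \<longrightarrow> (\<Gamma>, \<Delta>) \<in> provable H \<longrightarrow> (add_mset (Box \<phi>) \<Gamma>, \<Delta>) \<in> provable H)"

definition interpolant ::
  "'c lang \<Rightarrow> ('a, 'c) ptree set \<Rightarrow> ('a, 'c) fm multiset \<Rightarrow> ('a, 'c) fm multiset \<Rightarrow>
   ('a, 'c) fm multiset \<Rightarrow> ('a, 'c) fm multiset \<Rightarrow> ('a, 'c) fm \<Rightarrow> bool"
where
  "interpolant L H \<Sigma> \<Lambda> \<Theta> \<Delta> C \<longleftrightarrow>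
     form L C \<and> (\<Sigma>, add_mset C \<Theta>) \<in> provable H \<and> (add_mset C \<Lambda>, \<Delta>) \<in> provable H \<and>
     vars C \<subseteq> vars_mset (\<Sigma> + \<Theta>) \<inter> vars_mset (\<Lambda> + \<Delta>)"

definition strong_interpolation ::
  "'c lang \<Rightarrow> ('a, 'c) ptree set \<Rightarrow> ('a, 'c) ptree set \<Rightarrow> bool"
where
  "strong_interpolation L P H \<longleftrightarrow>
     (\<forall>\<pi>\<in>P. \<forall>\<Sigma> \<Lambda> \<Theta> \<Delta>. concl \<pi> = (\<Sigma> + \<Lambda>, \<Theta> + \<Delta>) \<longrightarrow> (\<exists>C. interpolant L H \<Sigma> \<Lambda> \<Theta> \<Delta> C))"

definition strong_feasible_interpolation ::
  "'c lang \<Rightarrow> ('a, 'c) ptree set \<Rightarrow> ('a, 'c) ptree set \<Rightarrow> bool"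
where
  "strong_feasible_interpolation L P H \<longleftrightarrow>
     (\<exists>k. \<forall>\<pi>\<in>P. \<forall>\<Sigma> \<Lambda> \<Theta> \<Delta>. concl \<pi> = (\<Sigma> + \<Lambda>, \<Theta> + \<Delta>) \<longrightarrow>
        (\<exists>C. interpolant L H \<Sigma> \<Lambda> \<Theta> \<Delta> C \<and> fsize C \<le> psize \<pi> ^ k + k))"

end

theory Submission imports Defs begin

text \<open>
  Maehara's method, by induction on the proof in \<open>H\<close>. If \<open>C\<close> interpolates a sequent with the two parts
  of the split exchanged, then \<open>C \<rightarrow> 0\<close> interpolates the original split, so the principal formula
  \<open>\<phi>\<close> may be assumed to lie in the first part \<open>\<Sigma> \<Rightarrow> \<Theta>\<close>. The auxiliary formulas of the premises are put there
  too. If \<open>C\<^sub>i\<^sub>r\<close> are the interpolants of the premises, the conclusion has the interpolant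
  \<open>\<Or>\<^sub>r C\<^sub>1\<^sub>r + \<dots> + \<Or>\<^sub>r C\<^sub>n\<^sub>r\<close>, where \<open>\<Or>\<^sub>r C\<^sub>i\<^sub>r\<close> enters the succedent context \<open>\<Delta>\<^sub>i\<close> of the rule. For modal
  rules the exchange puts the succedent into the second part, and \<open>\<box>C\<close> interpolates the
  conclusion if \<open>C\<close> interpolates the premise.

  Every premise is used once, so sizes add up, except that families without premises would
  contribute a \<open>\<bottom>\<close> each, and their number is not bounded by the size of the proof. All these families
  therefore share a single \<open>\<bottom>\<close>.
\<close>

section \<open>Well-formedness, variables and instances\<close>

lemma form_mset_simps [simp]:
  "form_mset L {#}"
  "form_mset L (add_mset \<phi> \<Gamma>) \<longleftrightarrow> form L \<phi> \<and> form_mset L \<Gamma>"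
  "form_mset L (\<Gamma> + \<Delta>) \<longleftrightarrow> form_mset L \<Gamma> \<and> form_mset L \<Delta>"
  by (auto simp: form_mset_def)

lemma form_mset_sum_list [simp]:
  "form_mset L (sum_list (map f xs)) \<longleftrightarrow> (\<forall>x\<in>set xs. form_mset L (f x))"
  by (induction xs) auto

lemma form_mset_image_Box:
  "has_box L \<Longrightarrow> form_mset L \<Gamma> \<Longrightarrow> form_mset L (image_mset Box \<Gamma>)"
  by (auto simp: form_mset_def)

lemma vars_mset_simps [simp]:
  "vars_mset {#} = {}"
  "vars_mset (add_mset \<phi> \<Gamma>) = vars \<phi> \<union> vars_mset \<Gamma>"
  "vars_mset (\<Gamma> + \<Delta>) = vars_mset \<Gamma> \<union> vars_mset \<Delta>"
  "vars_mset (image_mset Box \<Gamma>) = vars_mset \<Gamma>"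
  by (auto simp: vars_mset_def)

lemma vars_mset_sum_list [simp]: "vars_mset (sum_list (map f xs)) = (\<Union>x\<in>set xs. vars_mset (f x))"
  by (induction xs) auto

lemma form_subst: "form L \<phi> \<Longrightarrow> (\<And>a. form L (s a)) \<Longrightarrow> form L (subst s \<phi>)"
  by (induction \<phi>) auto

lemma form_inst_fm: "form L \<phi> \<Longrightarrow> (\<And>n. form L (\<sigma> n)) \<Longrightarrow> form L (inst_fm \<sigma> \<phi>)"
  by (auto simp: inst_fm_def intro!: form_subst split: matom.split)

lemma vars_subst: "vars (subst s \<phi>) = (\<Union>a\<in>vars \<phi>. vars (s a))"
  by (induction \<phi>) auto

lemma vars_inst_fm_mono: "vars \<chi> \<subseteq> vars \<phi> \<Longrightarrow> vars (inst_fm \<sigma> \<chi>) \<subseteq> vars (inst_fm \<sigma> \<phi>)"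
  by (auto simp: inst_fm_def vars_subst)

lemma inst_fm_simps [simp]:
  "inst_fm \<sigma> (Atom (FVar n)) = \<sigma> n"
  "inst_fm \<sigma> Zero = Zero"
  "inst_fm \<sigma> One = One"
  "inst_fm \<sigma> Top = Top"
  "inst_fm \<sigma> Bot = Bot"
  "inst_fm \<sigma> (And \<phi> \<psi>) = And (inst_fm \<sigma> \<phi>) (inst_fm \<sigma> \<psi>)"
  "inst_fm \<sigma> (Or \<phi> \<psi>) = Or (inst_fm \<sigma> \<phi>) (inst_fm \<sigma> \<psi>)"
  "inst_fm \<sigma> (Imp \<phi> \<psi>) = Imp (inst_fm \<sigma> \<phi>) (inst_fm \<sigma> \<psi>)"
  "inst_fm \<sigma> (Times \<phi> \<psi>) = Times (inst_fm \<sigma> \<phi>) (inst_fm \<sigma> \<psi>)"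
  "inst_fm \<sigma> (Plus \<phi> \<psi>) = Plus (inst_fm \<sigma> \<phi>) (inst_fm \<sigma> \<psi>)"
  "inst_fm \<sigma> (Box \<phi>) = Box (inst_fm \<sigma> \<phi>)"
  by (auto simp: inst_fm_def)

lemma form_mset_inst_item:
  "item_ok L x \<Longrightarrow> (\<And>n. form L (\<sigma> n)) \<Longrightarrow> (\<And>m. form_mset L (\<tau> m)) \<Longrightarrow> form_mset L (inst_item \<sigma> \<tau> x)"
  by (cases x) (auto intro: form_inst_fm form_mset_image_Box)

lemma form_mset_inst_items:
  assumes "\<forall>x\<in>#X. item_ok L x" "\<And>n. form L (\<sigma> n)" "\<And>m. form_mset L (\<tau> m)"
  shows "form_mset L (sum_mset (image_mset (inst_item \<sigma> \<tau>) X))"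
  using assms(1) by (induction X) (auto intro: form_mset_inst_item assms)

definition form_seq :: "'c lang \<Rightarrow> ('a, 'c) seq \<Rightarrow> bool" where
  "form_seq L S \<longleftrightarrow> form_mset L (fst S) \<and> form_mset L (snd S)"

text \<open>Rule instances put formulas of \<open>L\<close> into meta-sequents over
  \<open>L\<close>. Side conditions on the contexts of CFLe rules can therefore be read off from
  derivable premises.\<close>

lemma form_seq_ax_ext:
  assumes "calculus L R" "\<And>\<pi>. \<pi> \<in> B \<Longrightarrow> form_seq L (concl \<pi>)" "\<pi> \<in> ax_ext L B R"
  shows "form_seq L (concl \<pi>)"
  using assms(3)
proof induction
  case (step r \<pi>s S)
  then obtain \<sigma> \<tau> where *: "\<And>n. form L (\<sigma> n)" "\<And>m. form_mset L (\<tau> m)" "S = inst_seq \<sigma> \<tau> (snd r)"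
    by (auto simp: rule_instance_def)
  have "mseq_ok L (snd r)"
    using assms(1) step by (auto simp: calculus_def)
  then show ?case
    using * by (auto simp: mseq_ok_def form_seq_def inst_seq_def intro!: form_mset_inst_items)
qed (use assms in auto)

text \<open>Passes from proof trees to provable sequents: one proof is chosen for each occurrence of
  a premise, and the chosen proofs are listed as subproofs of a new node.\<close>

lemma provable_ax_ext_step:
  assumes "r \<in> R" "\<And>n. form L (\<sigma> n)" "\<And>m. form_mset L (\<tau> m)"
    and "\<forall>P\<in>#fst r. inst_seq \<sigma> \<tau> P \<in> provable (ax_ext L B R)"
  shows "inst_seq \<sigma> \<tau> (snd r) \<in> provable (ax_ext L B R)"
proof -
  have "\<exists>\<pi>s. set \<pi>s \<subseteq> ax_ext L B R \<and> mset (map concl \<pi>s) = image_mset (inst_seq \<sigma> \<tau>) Ps"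
    if "\<forall>P\<in>#Ps. inst_seq \<sigma> \<tau> P \<in> provable (ax_ext L B R)" for Ps
    using that
  proof (induction Ps)
    case (add P Ps)
    then obtain \<pi>s where "set \<pi>s \<subseteq> ax_ext L B R" "mset (map concl \<pi>s) = image_mset (inst_seq \<sigma> \<tau>) Ps"
      by auto
    moreover obtain \<pi> where "\<pi> \<in> ax_ext L B R" "concl \<pi> = inst_seq \<sigma> \<tau> P"
      using add.prems by (force simp: provable_def)
    ultimately show ?case
      by (intro exI[of _ "\<pi> # \<pi>s"]) auto
  qed auto
  then obtain \<pi>s where \<pi>s: "set \<pi>s \<subseteq> ax_ext L B R"
      "mset (map concl \<pi>s) = image_mset (inst_seq \<sigma> \<tau>) (fst r)"
    using assms(4) by blast
  have "Node (inst_seq \<sigma> \<tau> (snd r)) \<pi>s \<in> ax_ext L B R"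
    by (rule ax_ext.step[OF assms(1)]) (use \<pi>s assms in \<open>auto simp: rule_instance_def\<close>)
  then show ?thesis
    by (force simp: provable_def)
qed

section \<open>Splitting and assigning contexts\<close>

text \<open>Riesz refinement. \<open>C\<close> takes as much from \<open>A\<close> as possible, so
  \<open>A1 = A \<inter># C\<close>, \<open>B1 = C - A\<close> and \<open>A2 = A - C\<close>; the
  rest of \<open>D\<close> is \<open>B2\<close>.\<close>

lemma multiset_refinement:
  fixes A B C D :: "'x multiset"
  assumes "C + D = A + B"
  obtains A1 A2 B1 B2 where "C = A1 + B1" "D = A2 + B2" "A = A1 + A2" "B = B1 + B2"
proof -
  have *: "count C x + count D x = count A x + count B x" for x
    using assms by (metis count_union)
  have "count C x = min (count A x) (count C x) + (count C x - count A x)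
      \<and> count D x = (count A x - count C x) + (count D x - (count A x - count C x))
      \<and> count A x = min (count A x) (count C x) + (count A x - count C x)
      \<and> count B x = (count C x - count A x) + (count D x - (count A x - count C x))" for x
    using *[of x] by linarith
  then show ?thesis
    by (intro that[of "A \<inter># C" "C - A" "A - C" "D - (A - C)"]) (simp_all add: multiset_eq_iff)
qed

text \<open>Distributes a split of a conclusion over the contexts of its rule, by refining one
  context at a time. The pieces are functions of the list element, so equal entries would have to be
  split alike; hence \<open>distinct\<close>.\<close>

lemma sum_list_split:
  fixes f :: "'b \<Rightarrow> 'x multiset"
  assumes "distinct xs" "sum_list (map f xs) = A + B"
  obtains f1 f2 where "\<And>x. x \<in> set xs \<Longrightarrow> f x = f1 x + f2 x"
    "A = sum_list (map f1 xs)" "B = sum_list (map f2 xs)"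
proof -
  have "\<exists>f1 f2. (\<forall>x\<in>set xs. f x = f1 x + f2 x) \<and>
      A = sum_list (map f1 xs) \<and> B = sum_list (map f2 xs)"
    using assms
  proof (induction xs arbitrary: A B)
    case (Cons x xs)
    from Cons.prems have "f x + sum_list (map f xs) = A + B"
      by simp
    then obtain A1 A2 B1 B2 where *: "f x = A1 + B1" "sum_list (map f xs) = A2 + B2"
        "A = A1 + A2" "B = B1 + B2"
      by (rule multiset_refinement)
    obtain f1 f2 where f: "\<forall>x\<in>set xs. f x = f1 x + f2 x"
        "A2 = sum_list (map f1 xs)" "B2 = sum_list (map f2 xs)"
      using Cons.IH[OF _ *(2)] Cons.prems(1) by auto
    have "\<forall>y\<in>set (x # xs). f y = (f1(x := A1)) y + (f2(x := B1)) y"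
      using * f Cons.prems(1) by auto
    moreover have "A = sum_list (map (f1(x := A1)) (x # xs))" "B = sum_list (map (f2(x := B1)) (x # xs))"
      using * f Cons.prems(1) by (simp_all add: map_fun_upd del: fun_upd_apply) simp_all
    ultimately show ?case
      by blast
  qed auto
  then show ?thesis
    using that by blast
qed

text \<open>Lets a rule be instantiated again with prescribed contexts, which is possible because
  its context variables are pairwise distinct. All other variables get \<open>{#}\<close>; the bound
  on the range transfers well-formedness to \<open>\<tau>\<close>.\<close>

lemma ex_context_assignment:
  fixes a b :: "'i \<Rightarrow> 'x multiset" and g d :: "'i \<Rightarrow> nat"
  assumes "distinct (map g xs @ map d xs)"
  obtains \<tau> where "\<And>x. x \<in> set xs \<Longrightarrow> \<tau> (g x) = a x" "\<And>x. x \<in> set xs \<Longrightarrow> \<tau> (d x) = b x"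
    "range \<tau> \<subseteq> insert {#} (a ` set xs \<union> b ` set xs)"
proof -
  have "\<exists>\<tau>. (\<forall>x\<in>set xs. \<tau> (g x) = a x \<and> \<tau> (d x) = b x) \<and>
      range \<tau> \<subseteq> insert {#} (a ` set xs \<union> b ` set xs)"
    using assms
  proof (induction xs)
    case Nil
    show ?case
      by (intro exI[of _ "\<lambda>_. {#}"]) auto
  next
    case (Cons x xs)
    then obtain \<tau> where "\<forall>x\<in>set xs. \<tau> (g x) = a x \<and> \<tau> (d x) = b x"
        "range \<tau> \<subseteq> insert {#} (a ` set xs \<union> b ` set xs)"
      by auto
    moreover have "g x \<noteq> d x" "\<forall>y\<in>set xs. g y \<noteq> g x \<and> g y \<noteq> d x \<and> d y \<noteq> g x \<and> d y \<noteq> d x"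
      using Cons.prems by (auto simp: image_iff)
    ultimately show ?case
      by (intro exI[of _ "\<tau>(g x := a x, d x := b x)"]) (auto simp: image_subset_iff)
  qed
  then show ?thesis
    using that by blast
qed

section \<open>Instances of semi-analytic premises\<close>

lemma inst_items_MFm [simp]:
  "sum_mset (image_mset (inst_item \<sigma> \<tau>) (image_mset MFm X)) = image_mset (inst_fm \<sigma>) X"
  by (induction X) auto

lemma inst_items_left_ctx [simp]:
  "sum_mset (image_mset (inst_item \<sigma> \<tau>) (left_ctx fs)) = (\<Sum>x\<leftarrow>fs. \<tau> (fst x))"
  by (induction fs) (auto simp: left_ctx_def)

lemma inst_items_right_ctx [simp]:
  "sum_mset (image_mset (inst_item \<sigma> \<tau>) (right_ctx fs)) = (\<Sum>x\<leftarrow>fs. \<tau> (fst (snd x)))"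
  by (induction fs) (auto simp: right_ctx_def)

text \<open>Contexts are left out because the same auxiliary formulas are later combined with two
  different context assignments: that of the given instance and that of the rule application that
  yields the interpolant.\<close>

definition family_insts ::
  "(nat \<Rightarrow> ('a, 'c) fm) \<Rightarrow> ('a, 'c) family \<Rightarrow> (('a, 'c) fm multiset \<times> ('a, 'c) fm multiset) list"
where
  "family_insts \<sigma> x =
     map (map_prod (image_mset (inst_fm \<sigma>)) (image_mset (inst_fm \<sigma>))) (snd (snd x))"

lemma map_inst_seq_family_prems:
  "map (inst_seq \<sigma> \<tau>) (family_prems x) =
   map (\<lambda>(\<phi>s, \<psi>s). (\<tau> (fst x) + \<phi>s, \<tau> (fst (snd x)) + \<psi>s)) (family_insts \<sigma> x)"
  by (auto simp: family_prems_def family_insts_def inst_seq_def split: prod.splits)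

lemma inst_seq_sa_prems:
  "image_mset (inst_seq \<sigma> \<tau>) (sa_prems fs) =
   mset (concat (map (\<lambda>x. map (\<lambda>(\<phi>s, \<psi>s). (\<tau> (fst x) + \<phi>s, \<tau> (fst (snd x)) + \<psi>s))
     (family_insts \<sigma> x)) fs))"
  by (simp add: sa_prems_def map_inst_seq_family_prems[symmetric] map_concat comp_def flip: mset_map)

text \<open>The variable condition on semi-analytic rules survives substitution. So auxiliary
  formulas placed next to the principal formula bring no new variables into the interpolant.\<close>

lemma vars_mset_family_insts:
  assumes "\<forall>(\<phi>s, \<psi>s)\<in>set (snd (snd x)). \<forall>\<chi>\<in>#\<phi>s + \<psi>s. vars \<chi> \<subseteq> vars \<phi>"
    and "(\<phi>s, \<psi>s) \<in> set (family_insts \<sigma> x)"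
  shows "vars_mset (\<phi>s + \<psi>s) \<subseteq> vars (inst_fm \<sigma> \<phi>)"
proof -
  obtain \<phi>s' \<psi>s' where *: "(\<phi>s', \<psi>s') \<in> set (snd (snd x))"
      "\<phi>s = image_mset (inst_fm \<sigma>) \<phi>s'" "\<psi>s = image_mset (inst_fm \<sigma>) \<psi>s'"
    using assms(2) by (auto simp: family_insts_def)
  have "vars (inst_fm \<sigma> \<chi>) \<subseteq> vars (inst_fm \<sigma> \<phi>)" if "\<chi> \<in># \<phi>s' + \<psi>s'" for \<chi>
    using assms(1) *(1) that by (intro vars_inst_fm_mono) blast
  then show ?thesis
    using * by (auto simp: vars_mset_def)
qed

section \<open>Derivability in an extension of CFLe\<close>

text \<open>Constructing an interpolant for a single inference uses \<open>H\<close> only through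
  closure properties of its provable sequents; the induction over proofs comes afterwards.\<close>

locale cfle_extension =
  fixes L :: "'c lang" and H :: "('a, 'c) ptree set" and R :: "('a, 'c) rule set"
  assumes extends: "extends_CFLe L H"
    and form_provable: "S \<in> provable H \<Longrightarrow> form_seq L S"
    and closed: "\<And>r \<sigma> \<tau>. r \<in> R \<Longrightarrow> (\<And>n. form L (\<sigma> n)) \<Longrightarrow> (\<And>m. form_mset L (\<tau> m)) \<Longrightarrow>
        \<forall>P\<in>#fst r. inst_seq \<sigma> \<tau> P \<in> provable H \<Longrightarrow> inst_seq \<sigma> \<tau> (snd r) \<in> provable H"
begin

definition derivable :: "('a, 'c) fm multiset \<Rightarrow> ('a, 'c) fm multiset \<Rightarrow> bool"  (infix "\<turnstile>" 40) where
  "\<Gamma> \<turnstile> \<Delta> \<longleftrightarrow> (\<Gamma>, \<Delta>) \<in> provable H"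

lemma form_derivable: "\<Gamma> \<turnstile> \<Delta> \<Longrightarrow> form_mset L \<Gamma> \<and> form_mset L \<Delta>"
  using form_provable by (fastforce simp: derivable_def form_seq_def)

text \<open>A CFLe inference on top of \<open>H\<close>-proofs is a proof in
  \<open>ax_ext L H CFLe\<close>, so its conclusion is already provable in \<open>H\<close>.\<close>

lemma closed_CFLe:
  assumes "(Ps, S) \<in> CFLe" "\<And>n. form L (\<sigma> n)" "\<And>m. form_mset L (\<tau> m)"
    and "\<forall>P\<in>#Ps. inst_seq \<sigma> \<tau> P \<in> provable H"
  shows "inst_seq \<sigma> \<tau> S \<in> provable H"
proof -
  have "provable H \<subseteq> provable (ax_ext L H CFLe)"
    by (auto simp: provable_def intro: ax_ext.base)
  then have "inst_seq \<sigma> \<tau> (snd (Ps, S)) \<in> provable (ax_ext L H CFLe)"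
    using assms by (intro provable_ax_ext_step) auto
  then show ?thesis
    using extends by (auto simp: extends_CFLe_def)
qed

lemma ZeroL: "{#Zero#} \<turnstile> {#}"
  using closed_CFLe[of "{#}" "({#MFm Zero#}, {#})" "\<lambda>_. Zero" "\<lambda>_. {#}"]
  by (auto simp: CFLe_def Let_def inst_seq_def derivable_def)

lemma ZeroR: "\<Gamma> \<turnstile> \<Delta> \<Longrightarrow> \<Gamma> \<turnstile> add_mset Zero \<Delta>"
  using closed_CFLe[of "{#({#MVar 0#}, {#MVar 1#})#}" "({#MVar 0#}, {#MFm Zero, MVar 1#})"
      "\<lambda>_. Zero" "\<lambda>n. if n = 0 then \<Gamma> else \<Delta>"] form_derivable[of \<Gamma> \<Delta>]
  by (auto simp: CFLe_def Let_def inst_seq_def derivable_def)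

lemma BotL: "form_mset L \<Gamma> \<Longrightarrow> form_mset L \<Delta> \<Longrightarrow> add_mset Bot \<Gamma> \<turnstile> \<Delta>"
  using closed_CFLe[of "{#}" "({#MVar 0, MFm Bot#}, {#MVar 1#})"
      "\<lambda>_. Zero" "\<lambda>n. if n = 0 then \<Gamma> else \<Delta>"]
  by (auto simp: CFLe_def Let_def inst_seq_def derivable_def)

lemma OrL: "add_mset A \<Gamma> \<turnstile> \<Delta> \<Longrightarrow> add_mset B \<Gamma> \<turnstile> \<Delta> \<Longrightarrow> add_mset (Or A B) \<Gamma> \<turnstile> \<Delta>"
  using closed_CFLe[of "{#({#MVar 0, mF 0#}, {#MVar 1#}), ({#MVar 0, mF 1#}, {#MVar 1#})#}"
      "({#MVar 0, MFm (Or (Atom (FVar 0)) (Atom (FVar 1)))#}, {#MVar 1#})"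
      "\<lambda>n. if n = 0 then A else B" "\<lambda>n. if n = 0 then \<Gamma> else \<Delta>"]
    form_derivable[of "add_mset A \<Gamma>" \<Delta>] form_derivable[of "add_mset B \<Gamma>" \<Delta>]
  by (auto simp: CFLe_def Let_def inst_seq_def derivable_def)

lemma OrR1: "\<Gamma> \<turnstile> add_mset A \<Delta> \<Longrightarrow> form L B \<Longrightarrow> \<Gamma> \<turnstile> add_mset (Or A B) \<Delta>"
  using closed_CFLe[of "{#({#MVar 0#}, {#mF 0, MVar 1#})#}"
      "({#MVar 0#}, {#MFm (Or (Atom (FVar 0)) (Atom (FVar 1))), MVar 1#})"
      "\<lambda>n. if n = 0 then A else B" "\<lambda>n. if n = 0 then \<Gamma> else \<Delta>"]
    form_derivable[of \<Gamma> "add_mset A \<Delta>"]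
  by (auto simp: CFLe_def Let_def inst_seq_def derivable_def)

lemma OrR2: "\<Gamma> \<turnstile> add_mset B \<Delta> \<Longrightarrow> form L A \<Longrightarrow> \<Gamma> \<turnstile> add_mset (Or A B) \<Delta>"
  using closed_CFLe[of "{#({#MVar 0#}, {#mF 1, MVar 1#})#}"
      "({#MVar 0#}, {#MFm (Or (Atom (FVar 0)) (Atom (FVar 1))), MVar 1#})"
      "\<lambda>n. if n = 0 then A else B" "\<lambda>n. if n = 0 then \<Gamma> else \<Delta>"]
    form_derivable[of \<Gamma> "add_mset B \<Delta>"]
  by (auto simp: CFLe_def Let_def inst_seq_def derivable_def)

lemma ImpL:
  "\<Gamma> \<turnstile> add_mset A \<Delta> \<Longrightarrow> add_mset B \<Sigma> \<turnstile> \<Lambda> \<Longrightarrow> add_mset (Imp A B) (\<Gamma> + \<Sigma>) \<turnstile> \<Delta> + \<Lambda>"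
  using closed_CFLe[of "{#({#MVar 0#}, {#mF 0, MVar 1#}), ({#MVar 2, mF 1#}, {#MVar 3#})#}"
      "({#MVar 0, MVar 2, MFm (Imp (Atom (FVar 0)) (Atom (FVar 1)))#}, {#MVar 1, MVar 3#})"
      "\<lambda>n. if n = 0 then A else B"
      "\<lambda>n. if n = 0 then \<Gamma> else if n = 1 then \<Delta> else if n = 2 then \<Sigma> else \<Lambda>"]
    form_derivable[of \<Gamma> "add_mset A \<Delta>"] form_derivable[of "add_mset B \<Sigma>" \<Lambda>]
  by (auto simp: CFLe_def Let_def inst_seq_def derivable_def)

lemma ImpR: "add_mset A \<Gamma> \<turnstile> add_mset B \<Delta> \<Longrightarrow> \<Gamma> \<turnstile> add_mset (Imp A B) \<Delta>"
  using closed_CFLe[of "{#({#MVar 0, mF 0#}, {#mF 1, MVar 1#})#}"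
      "({#MVar 0#}, {#MFm (Imp (Atom (FVar 0)) (Atom (FVar 1))), MVar 1#})"
      "\<lambda>n. if n = 0 then A else B" "\<lambda>n. if n = 0 then \<Gamma> else \<Delta>"]
    form_derivable[of "add_mset A \<Gamma>" "add_mset B \<Delta>"]
  by (auto simp: CFLe_def Let_def inst_seq_def derivable_def)

lemma PlusL:
  "add_mset A \<Gamma> \<turnstile> \<Delta> \<Longrightarrow> add_mset B \<Sigma> \<turnstile> \<Lambda> \<Longrightarrow> add_mset (Plus A B) (\<Gamma> + \<Sigma>) \<turnstile> \<Delta> + \<Lambda>"
  using closed_CFLe[of "{#({#MVar 0, mF 0#}, {#MVar 1#}), ({#MVar 2, mF 1#}, {#MVar 3#})#}"
      "({#MVar 0, MVar 2, MFm (Plus (Atom (FVar 0)) (Atom (FVar 1)))#}, {#MVar 1, MVar 3#})"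
      "\<lambda>n. if n = 0 then A else B"
      "\<lambda>n. if n = 0 then \<Gamma> else if n = 1 then \<Delta> else if n = 2 then \<Sigma> else \<Lambda>"]
    form_derivable[of "add_mset A \<Gamma>" \<Delta>] form_derivable[of "add_mset B \<Sigma>" \<Lambda>]
  by (auto simp: CFLe_def Let_def inst_seq_def derivable_def)

lemma PlusR: "\<Gamma> \<turnstile> add_mset A (add_mset B \<Delta>) \<Longrightarrow> \<Gamma> \<turnstile> add_mset (Plus A B) \<Delta>"
  using closed_CFLe[of "{#({#MVar 0#}, {#mF 0, mF 1, MVar 1#})#}"
      "({#MVar 0#}, {#MFm (Plus (Atom (FVar 0)) (Atom (FVar 1))), MVar 1#})"
      "\<lambda>n. if n = 0 then A else B" "\<lambda>n. if n = 0 then \<Gamma> else \<Delta>"]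
    form_derivable[of \<Gamma> "add_mset A (add_mset B \<Delta>)"]
  by (auto simp: CFLe_def Let_def inst_seq_def derivable_def add_mset_commute)

section \<open>Interpolants and the exchange of the two parts\<close>

abbreviation "neg C \<equiv> Imp C Zero"

text \<open>\<open>ImpL\<close> against \<open>ZeroL\<close> moves \<open>C\<close> from succedent
  to antecedent, and \<open>ZeroR\<close> followed by \<open>ImpR\<close> moves it the other way.
  The size grows by 2, whence the steps from 3 to 5 and from 1 to 3 in the bounds below.\<close>

lemma interpolant_swap:
  assumes "interpolant L H \<Lambda> \<Sigma> \<Delta> \<Theta> C"
  shows "interpolant L H \<Sigma> \<Lambda> \<Theta> \<Delta> (neg C)"
proof -
  have "\<Lambda> \<turnstile> add_mset C \<Delta>" "add_mset C \<Sigma> \<turnstile> \<Theta>"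
    using assms by (auto simp: interpolant_def derivable_def)
  then have "add_mset (neg C) \<Lambda> \<turnstile> \<Delta>" "\<Sigma> \<turnstile> add_mset (neg C) \<Theta>"
    using ImpL[OF _ ZeroL, of \<Lambda> C \<Delta>] ImpR[OF ZeroR] by auto
  then show ?thesis
    using assms by (auto simp: interpolant_def derivable_def)
qed

text \<open>The flag \<open>b\<close> tells whether the size bound is imposed, so that both halves of the theorem share one proof.\<close>

definition split_interpolable :: "bool \<Rightarrow> nat \<Rightarrow> ('a, 'c) seq \<Rightarrow> bool" where
  "split_interpolable b n S \<longleftrightarrow>
     (\<forall>\<Sigma> \<Lambda> \<Theta> \<Delta>. S = (\<Sigma> + \<Lambda>, \<Theta> + \<Delta>) \<longrightarrow>
        (\<exists>C. interpolant L H \<Sigma> \<Lambda> \<Theta> \<Delta> C \<and> (b \<longrightarrow> fsize C \<le> n)))"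

lemma split_interpolableE:
  assumes "split_interpolable b n S" "S = (\<Sigma> + \<Lambda>, \<Theta> + \<Delta>)"
  obtains C where "form L C" "\<Sigma> \<turnstile> add_mset C \<Theta>" "add_mset C \<Lambda> \<turnstile> \<Delta>"
    "vars C \<subseteq> vars_mset (\<Sigma> + \<Theta>) \<inter> vars_mset (\<Lambda> + \<Delta>)" "b \<Longrightarrow> fsize C \<le> n"
  using assms that unfolding split_interpolable_def interpolant_def derivable_def by blast

section \<open>Semi-analytic rules\<close>

text \<open>All premises of a family share the second part
  \<open>\<Lambda> \<Rightarrow> \<Delta>\<close>, so \<open>OrL\<close> applies there to the
  disjunction of their interpolants, while \<open>OrR1\<close> and \<open>OrR2\<close> introduce it
  in each first part. \<open>Bot\<close> is the empty disjunction; each premise costs one more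
  \<open>Or\<close>.\<close>

lemma family_interpolant:
  assumes "form_mset L \<Lambda>" "form_mset L \<Delta>"
    and "\<forall>(\<phi>s, \<psi>s)\<in>set qs. split_interpolable b (n (\<Sigma> + \<Lambda> + \<phi>s, \<Theta> + \<Delta> + \<psi>s))
            (\<Sigma> + \<Lambda> + \<phi>s, \<Theta> + \<Delta> + \<psi>s)"
    and "\<forall>(\<phi>s, \<psi>s)\<in>set qs. vars_mset (\<phi>s + \<psi>s) \<subseteq> W"
  shows "\<exists>C. form L C \<and> add_mset C \<Lambda> \<turnstile> \<Delta> \<and>
    (\<forall>(\<phi>s, \<psi>s)\<in>set qs. \<Sigma> + \<phi>s \<turnstile> add_mset C (\<Theta> + \<psi>s)) \<and>
    vars C \<subseteq> (W \<union> vars_mset (\<Sigma> + \<Theta>)) \<inter> vars_mset (\<Lambda> + \<Delta>) \<and>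
    (b \<longrightarrow> fsize C \<le> (\<Sum>(\<phi>s, \<psi>s)\<leftarrow>qs. n (\<Sigma> + \<Lambda> + \<phi>s, \<Theta> + \<Delta> + \<psi>s) + 1) + 1)"
  using assms(3,4)
proof (induction qs)
  case Nil
  show ?case
    using assms(1,2) by (intro exI[of _ Bot]) (auto intro: BotL)
next
  case (Cons q qs)
  obtain \<phi>s \<psi>s where q: "q = (\<phi>s, \<psi>s)"
    by (cases q)
  obtain D where D: "form L D" "add_mset D \<Lambda> \<turnstile> \<Delta>"
    "\<And>\<phi>s \<psi>s. (\<phi>s, \<psi>s) \<in> set qs \<Longrightarrow> \<Sigma> + \<phi>s \<turnstile> add_mset D (\<Theta> + \<psi>s)"
    "vars D \<subseteq> (W \<union> vars_mset (\<Sigma> + \<Theta>)) \<inter> vars_mset (\<Lambda> + \<Delta>)"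
    "b \<Longrightarrow> fsize D \<le> (\<Sum>(\<phi>s, \<psi>s)\<leftarrow>qs. n (\<Sigma> + \<Lambda> + \<phi>s, \<Theta> + \<Delta> + \<psi>s) + 1) + 1"
    using Cons.IH Cons.prems by fastforce
  have "split_interpolable b (n (\<Sigma> + \<Lambda> + \<phi>s, \<Theta> + \<Delta> + \<psi>s)) (\<Sigma> + \<Lambda> + \<phi>s, \<Theta> + \<Delta> + \<psi>s)"
    using Cons.prems q by simp
  then obtain C where C: "form L C" "\<Sigma> + \<phi>s \<turnstile> add_mset C (\<Theta> + \<psi>s)" "add_mset C \<Lambda> \<turnstile> \<Delta>"
    "vars C \<subseteq> vars_mset (\<Sigma> + \<phi>s + (\<Theta> + \<psi>s)) \<inter> vars_mset (\<Lambda> + \<Delta>)"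
    "b \<Longrightarrow> fsize C \<le> n (\<Sigma> + \<Lambda> + \<phi>s, \<Theta> + \<Delta> + \<psi>s)"
    by (rule split_interpolableE[where \<Sigma> = "\<Sigma> + \<phi>s" and \<Lambda> = \<Lambda> and \<Theta> = "\<Theta> + \<psi>s" and \<Delta> = \<Delta>])
      (auto simp: ac_simps)
  have W: "vars_mset (\<phi>s + \<psi>s) \<subseteq> W"
    using Cons.prems(2) q by simp
  show ?case
  proof (intro exI[of _ "Or C D"] conjI)
    show "add_mset (Or C D) \<Lambda> \<turnstile> \<Delta>"
      using C D by (intro OrL)
    show "\<forall>(\<phi>s, \<psi>s)\<in>set (q # qs). \<Sigma> + \<phi>s \<turnstile> add_mset (Or C D) (\<Theta> + \<psi>s)"
      using C D q by (auto intro: OrR1 OrR2)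
  qed (use C D q W in auto)
qed

text \<open>
  \<open>e x\<close> is what the family \<open>x\<close> contributes to the interpolant; \<open>C\<close> is the sum of all contributions.
  If some family has no premises, then \<open>\<bottom>\<close> is a summand of \<open>C\<close>, which absorbs the contexts of
  all further such families at no cost.
\<close>

lemma families_interpolant:
  fixes S T U V :: "'i \<Rightarrow> ('a, 'c) fm multiset" and Q :: "'i \<Rightarrow> (('a, 'c) fm multiset \<times> ('a, 'c) fm multiset) list"
  assumes "distinct xs"
    and "\<forall>x\<in>set xs. form_mset L (T x) \<and> form_mset L (V x)"
    and "\<forall>x\<in>set xs. \<forall>(\<phi>s, \<psi>s)\<in>set (Q x).
        split_interpolable b (n (S x + T x + \<phi>s, U x + V x + \<psi>s)) (S x + T x + \<phi>s, U x + V x + \<psi>s)"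
    and "\<forall>x\<in>set xs. \<forall>(\<phi>s, \<psi>s)\<in>set (Q x). vars_mset (\<phi>s + \<psi>s) \<subseteq> W"
  shows "\<exists>e C. form L C \<and> (\<forall>x. form_mset L (e x)) \<and>
    (\<forall>x\<in>set xs. \<forall>(\<phi>s, \<psi>s)\<in>set (Q x). S x + \<phi>s \<turnstile> U x + e x + \<psi>s) \<and>
    (\<forall>\<Gamma> \<Delta>. \<Gamma> \<turnstile> (\<Sum>x\<leftarrow>xs. e x) + \<Delta> \<longrightarrow> \<Gamma> \<turnstile> add_mset C \<Delta>) \<and>
    add_mset C (\<Sum>x\<leftarrow>xs. T x) \<turnstile> (\<Sum>x\<leftarrow>xs. V x) \<and>
    ((\<exists>x\<in>set xs. Q x = []) \<longrightarrow> (\<forall>\<Gamma> \<Delta>. form_mset L \<Gamma> \<longrightarrow> form_mset L \<Delta> \<longrightarrow>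
        add_mset C (\<Gamma> + (\<Sum>x\<leftarrow>xs. T x)) \<turnstile> \<Delta> + (\<Sum>x\<leftarrow>xs. V x))) \<and>
    vars C \<subseteq> (W \<union> (\<Union>x\<in>set xs. vars_mset (S x + U x))) \<inter> (\<Union>x\<in>set xs. vars_mset (T x + V x)) \<and>
    (b \<longrightarrow> fsize C \<le> (\<Sum>x\<leftarrow>xs. \<Sum>(\<phi>s, \<psi>s)\<leftarrow>Q x. n (S x + T x + \<phi>s, U x + V x + \<psi>s) + 3) + 1 +
        (if \<exists>x\<in>set xs. Q x = [] then 2 else 0))"
    (is "\<exists>e C. ?P xs e C")
  using assms
proof (induction xs)
  case Nil
  \<comment> \<open>\<open>Zero\<close> is the empty sum.\<close>
  show ?case
    by (rule exI[of _ "\<lambda>_. {#}"], rule exI[of _ Zero]) (auto intro: ZeroL ZeroR)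
next
  case (Cons x xs)
  define N where "N x = (\<Sum>(\<phi>s, \<psi>s)\<leftarrow>Q x. n (S x + T x + \<phi>s, U x + V x + \<psi>s) + 3)" for x
  have "\<exists>e C. ?P xs e C"
    by (rule Cons.IH) (use Cons.prems in simp_all)
  then obtain e C where "form L C" and form_e: "\<forall>x. form_mset L (e x)"
    and prems: "\<forall>x\<in>set xs. \<forall>(\<phi>s, \<psi>s)\<in>set (Q x). S x + \<phi>s \<turnstile> U x + e x + \<psi>s"
    and join: "\<forall>\<Gamma> \<Delta>. \<Gamma> \<turnstile> (\<Sum>x\<leftarrow>xs. e x) + \<Delta> \<longrightarrow> \<Gamma> \<turnstile> add_mset C \<Delta>"
    and C: "add_mset C (\<Sum>x\<leftarrow>xs. T x) \<turnstile> (\<Sum>x\<leftarrow>xs. V x)"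
    and absorb: "(\<exists>x\<in>set xs. Q x = []) \<longrightarrow> (\<forall>\<Gamma> \<Delta>. form_mset L \<Gamma> \<longrightarrow> form_mset L \<Delta> \<longrightarrow>
        add_mset C (\<Gamma> + (\<Sum>x\<leftarrow>xs. T x)) \<turnstile> \<Delta> + (\<Sum>x\<leftarrow>xs. V x))"
    and vars_C: "vars C \<subseteq> (W \<union> (\<Union>x\<in>set xs. vars_mset (S x + U x))) \<inter>
        (\<Union>x\<in>set xs. vars_mset (T x + V x))"
    and size_C: "b \<longrightarrow> fsize C \<le> (\<Sum>x\<leftarrow>xs. N x) + 1 + (if \<exists>x\<in>set xs. Q x = [] then 2 else 0)"
    unfolding N_def[symmetric] by (elim exE conjE) rule
  have x: "x \<notin> set xs" "form_mset L (T x)" "form_mset L (V x)"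
    using Cons.prems(1,2) by auto
  have N_empty: "Q x = [] \<Longrightarrow> N x = 0"
    by (simp add: N_def)
  show ?case
  \<comment> \<open>A premise-free family is dropped from the sum if \<open>C\<close> already
    contains the shared \<open>Bot\<close>.\<close>
  proof (cases "Q x = [] \<and> (\<exists>x\<in>set xs. Q x = [])")
    case True
    have e_upd: "map (e(x := {#})) xs = map e xs"
      using x by (simp add: map_fun_upd)
    show ?thesis
      unfolding N_def[symmetric]
    \<comment> \<open>Without premises, nothing is demanded of the contribution of \<open>x\<close>;
      its contexts \<open>T x\<close> and \<open>V x\<close> are absorbed by
      \<open>C\<close>.\<close>
    proof (rule exI[of _ "e(x := {#})"], rule exI[of _ C], intro conjI allI impI)
      fix \<Gamma> \<Delta> :: "('a, 'c) fm multiset"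
      assume "\<Gamma> \<turnstile> (\<Sum>y\<leftarrow>x # xs. (e(x := {#})) y) + \<Delta>"
      then show "\<Gamma> \<turnstile> add_mset C \<Delta>"
        using e_upd join by (simp del: fun_upd_apply) simp
    next
      show "add_mset C (\<Sum>x\<leftarrow>x # xs. T x) \<turnstile> (\<Sum>x\<leftarrow>x # xs. V x)"
        using absorb True x by simp
    next
      fix \<Gamma> \<Delta> :: "('a, 'c) fm multiset"
      assume "form_mset L \<Gamma>" "form_mset L \<Delta>"
      then show "add_mset C (\<Gamma> + (\<Sum>x\<leftarrow>x # xs. T x)) \<turnstile> \<Delta> + (\<Sum>x\<leftarrow>x # xs. V x)"
        using absorb[rule_format, of "\<Gamma> + T x" "\<Delta> + V x"] True x by (simp add: ac_simps)
    qed (use \<open>form L C\<close> form_e prems vars_C size_C True x N_empty in auto)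
  next
    case False
    obtain D where D: "form L D" "add_mset D (T x) \<turnstile> V x"
      "\<And>\<phi>s \<psi>s. (\<phi>s, \<psi>s) \<in> set (Q x) \<Longrightarrow> S x + \<phi>s \<turnstile> add_mset D (U x + \<psi>s)"
      "vars D \<subseteq> (W \<union> vars_mset (S x + U x)) \<inter> vars_mset (T x + V x)"
      "\<And>\<Gamma> \<Delta>. Q x = [] \<Longrightarrow> form_mset L \<Gamma> \<Longrightarrow> form_mset L \<Delta> \<Longrightarrow> add_mset D (\<Gamma> + T x) \<turnstile> \<Delta> + V x"
      "b \<Longrightarrow> fsize D + 1 \<le> N x + (if Q x = [] then 2 else 0)"
    proof (cases "Q x = []")
      case True
      show ?thesis
        \<comment> \<open>The surcharge 2 pays for this \<open>Bot\<close> and for the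
          \<open>Plus\<close> that attaches it.\<close>
        by (rule that[of Bot]) (use True x in \<open>auto intro: BotL\<close>)
    next
      case False
      have "\<forall>(\<phi>s, \<psi>s)\<in>set (Q x). split_interpolable b (n (S x + T x + \<phi>s, U x + V x + \<psi>s))
          (S x + T x + \<phi>s, U x + V x + \<psi>s)"
        "\<forall>(\<phi>s, \<psi>s)\<in>set (Q x). vars_mset (\<phi>s + \<psi>s) \<subseteq> W"
        using Cons.prems(3,4) by simp_all
      from family_interpolant[OF x(2,3) this]
      obtain D where D: "form L D" "add_mset D (T x) \<turnstile> V x"
        "\<And>\<phi>s \<psi>s. (\<phi>s, \<psi>s) \<in> set (Q x) \<Longrightarrow> S x + \<phi>s \<turnstile> add_mset D (U x + \<psi>s)"
        "vars D \<subseteq> (W \<union> vars_mset (S x + U x)) \<inter> vars_mset (T x + V x)"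
        "b \<Longrightarrow> fsize D \<le> (\<Sum>(\<phi>s, \<psi>s)\<leftarrow>Q x. n (S x + T x + \<phi>s, U x + V x + \<psi>s) + 1) + 1"
        by (elim exE conjE) (rule that; blast)
      \<comment> \<open>Of the 3 units per premise, one pays for an \<open>Or\<close>. As the family
        has a premise, the remaining two cover its final \<open>Bot\<close> and the
        \<open>Plus\<close> that attaches it.\<close>
      have "(\<Sum>(\<phi>s, \<psi>s)\<leftarrow>qs. k \<phi>s \<psi>s + 3) = (\<Sum>(\<phi>s, \<psi>s)\<leftarrow>qs. k \<phi>s \<psi>s + 1) + 2 * length qs"
        for k :: "('a, 'c) fm multiset \<Rightarrow> ('a, 'c) fm multiset \<Rightarrow> nat" and qs
        by (induction qs) auto
      then have "N x = (\<Sum>(\<phi>s, \<psi>s)\<leftarrow>Q x. n (S x + T x + \<phi>s, U x + V x + \<psi>s) + 1) + 2 * length (Q x)"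
        unfolding N_def by simp
      moreover have "length (Q x) \<ge> 1"
        using False by (simp add: Suc_le_eq)
      ultimately show ?thesis
        using False D by (intro that[of D]) auto
    qed
    have e_upd: "map (e(x := {#D#})) xs = map e xs"
      using x by (simp add: map_fun_upd)
    show ?thesis
      unfolding N_def[symmetric]
    proof (rule exI[of _ "e(x := {#D#})"], rule exI[of _ "Plus D C"], intro conjI allI impI)
      fix \<Gamma> \<Delta> :: "('a, 'c) fm multiset"
      assume "\<Gamma> \<turnstile> (\<Sum>y\<leftarrow>x # xs. (e(x := {#D#})) y) + \<Delta>"
      then have "\<Gamma> \<turnstile> (\<Sum>x\<leftarrow>xs. e x) + add_mset D \<Delta>"
        using e_upd by (simp del: fun_upd_apply) simp
      then show "\<Gamma> \<turnstile> add_mset (Plus D C) \<Delta>"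
        using join[rule_format, of \<Gamma> "add_mset D \<Delta>"] by (intro PlusR) (simp add: add_mset_commute)
    next
      show "add_mset (Plus D C) (\<Sum>x\<leftarrow>x # xs. T x) \<turnstile> (\<Sum>x\<leftarrow>x # xs. V x)"
        using PlusL[OF D(2) C] by simp
    next
      fix \<Gamma> \<Delta> :: "('a, 'c) fm multiset"
      assume "\<exists>x\<in>set (x # xs). Q x = []" and \<Gamma>\<Delta>: "form_mset L \<Gamma>" "form_mset L \<Delta>"
      then consider "Q x = []" | "\<exists>x\<in>set xs. Q x = []"
        by auto
      then show "add_mset (Plus D C) (\<Gamma> + (\<Sum>x\<leftarrow>x # xs. T x)) \<turnstile> \<Delta> + (\<Sum>x\<leftarrow>x # xs. V x)"
      \<comment> \<open>The extra contexts go to whichever summand can absorb them: \<open>D\<close>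
        in the first case, \<open>C\<close> in the second.\<close>
      proof cases
        case 1
        then show ?thesis
          using PlusL[OF D(5) C] \<Gamma>\<Delta> by (simp add: ac_simps)
      next
        case 2
        then show ?thesis
          using PlusL[OF D(2) absorb[rule_format]] \<Gamma>\<Delta> by (simp add: ac_simps)
      qed
    next
      assume b
      \<comment> \<open>At most one of the two surcharges is nonzero, since the case of both was
        treated above.\<close>
      have "fsize D + 1 \<le> N x + (if Q x = [] then 2 else 0)"
        "fsize C \<le> (\<Sum>x\<leftarrow>xs. N x) + 1 + (if \<exists>x\<in>set xs. Q x = [] then 2 else 0)"
        using size_C D(6) \<open>b\<close> by auto
      then show "fsize (Plus D C) \<le> (\<Sum>x\<leftarrow>x # xs. N x) + 1 + (if \<exists>x\<in>set (x # xs). Q x = [] then 2 else 0)"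
        using False by (auto split: if_splits)
    next
      show "\<forall>y\<in>set (x # xs). \<forall>(\<phi>s, \<psi>s)\<in>set (Q y). S y + \<phi>s \<turnstile> U y + (e(x := {#D#})) y + \<psi>s"
        using prems D(3) x by auto
    qed (use \<open>form L C\<close> form_e vars_C D(1,4) in auto)
  qed
qed

text \<open>\<open>A\<close> and \<open>B\<close> treat left and right rules at once: one of them is
  the principal formula, the other empty. The rule is applied again to the first halves of its
  premises, and their contributions are then joined into \<open>C\<close>. The final 3 pays for
  \<open>Zero\<close> and for the shared \<open>Bot\<close> with its \<open>Plus\<close>.\<close>

lemma semi_analytic_interpolant:
  assumes r: "(sa_prems fs, (image_mset MFm A + left_ctx fs, image_mset MFm B + right_ctx fs)) \<in> R"
    and sa: "sa_condition fs \<phi>" and AB: "A + B = {#\<phi>#}"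
    and \<sigma>: "\<And>n. form L (\<sigma> n)" and \<tau>: "\<And>m. form_mset L (\<tau> m)"
    and prems: "\<forall>P\<in>#image_mset (inst_seq \<sigma> \<tau>) (sa_prems fs). split_interpolable b (n P) P"
    and left: "(\<Sum>x\<leftarrow>fs. \<tau> (fst x)) = \<Sigma> + \<Lambda>"
    and right: "(\<Sum>x\<leftarrow>fs. \<tau> (fst (snd x))) = \<Theta> + \<Delta>"
  shows "\<exists>C. interpolant L H (image_mset (inst_fm \<sigma>) A + \<Sigma>) \<Lambda> (image_mset (inst_fm \<sigma>) B + \<Theta>) \<Delta> C \<and>
    (b \<longrightarrow> fsize C \<le> (\<Sum>P\<in>#image_mset (inst_seq \<sigma> \<tau>) (sa_prems fs). n P + 3) + 3)"
proof -
  have dist: "distinct (map fst fs @ map (\<lambda>x. fst (snd x)) fs)"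
    using sa by (simp add: sa_condition_def case_prod_unfold)
  then have "distinct fs"
    by (simp add: distinct_map)
  obtain S T where ST: "\<And>x. x \<in> set fs \<Longrightarrow> \<tau> (fst x) = S x + T x"
      "\<Sigma> = (\<Sum>x\<leftarrow>fs. S x)" "\<Lambda> = (\<Sum>x\<leftarrow>fs. T x)"
    using sum_list_split[OF \<open>distinct fs\<close> left] by metis
  obtain U V where UV: "\<And>x. x \<in> set fs \<Longrightarrow> \<tau> (fst (snd x)) = U x + V x"
      "\<Theta> = (\<Sum>x\<leftarrow>fs. U x)" "\<Delta> = (\<Sum>x\<leftarrow>fs. V x)"
    using sum_list_split[OF \<open>distinct fs\<close> right] by metis
  have forms: "form_mset L (S x) \<and> form_mset L (T x) \<and> form_mset L (U x) \<and> form_mset L (V x)"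
    if "x \<in> set fs" for x
    using \<tau>[of "fst x"] \<tau>[of "fst (snd x)"] ST(1) UV(1) that by auto
  define Q where "Q = family_insts \<sigma>"
  have P_eq: "image_mset (inst_seq \<sigma> \<tau>) (sa_prems fs) =
      mset (concat (map (\<lambda>x. map (\<lambda>(\<phi>s, \<psi>s). (S x + T x + \<phi>s, U x + V x + \<psi>s)) (Q x)) fs))"
    unfolding inst_seq_sa_prems Q_def using ST(1) UV(1)
    by (intro arg_cong[of _ _ "\<lambda>l. mset (concat l)"] map_cong) auto
  have "(\<Sum>P\<in>#mset (concat (map (\<lambda>x. map (\<lambda>(\<phi>s, \<psi>s). (S x + T x + \<phi>s, U x + V x + \<psi>s)) (Q x)) xs)). n P + 3) =
      (\<Sum>x\<leftarrow>xs. \<Sum>(\<phi>s, \<psi>s)\<leftarrow>Q x. n (S x + T x + \<phi>s, U x + V x + \<psi>s) + 3)" for xs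
    by (induction xs) (auto simp: sum_mset_sum_list comp_def split_beta simp flip: mset_map)
  then have size: "(\<Sum>P\<in>#image_mset (inst_seq \<sigma> \<tau>) (sa_prems fs). n P + 3) =
      (\<Sum>x\<leftarrow>fs. \<Sum>(\<phi>s, \<psi>s)\<leftarrow>Q x. n (S x + T x + \<phi>s, U x + V x + \<psi>s) + 3)"
    unfolding P_eq .
  have TV: "\<forall>x\<in>set fs. form_mset L (T x) \<and> form_mset L (V x)"
    using forms by simp
  have split: "\<forall>x\<in>set fs. \<forall>(\<phi>s, \<psi>s)\<in>set (Q x).
      split_interpolable b (n (S x + T x + \<phi>s, U x + V x + \<psi>s)) (S x + T x + \<phi>s, U x + V x + \<psi>s)"
    using prems unfolding P_eq by fastforce
  have vars_Q: "\<forall>x\<in>set fs. \<forall>(\<phi>s, \<psi>s)\<in>set (Q x). vars_mset (\<phi>s + \<psi>s) \<subseteq> vars (inst_fm \<sigma> \<phi>)"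
  proof clarify
    fix g d ps \<phi>s \<psi>s \<chi>
    assume x: "(g, d, ps) \<in> set fs" and q: "(\<phi>s, \<psi>s) \<in> set (Q (g, d, ps))" and "\<chi> \<in> vars_mset (\<phi>s + \<psi>s)"
    moreover have "vars_mset (\<phi>s + \<psi>s) \<subseteq> vars (inst_fm \<sigma> \<phi>)"
      by (rule vars_mset_family_insts[OF _ q[unfolded Q_def]])
        (use bspec[OF conjunct2[OF sa[unfolded sa_condition_def]] x] in simp)
    ultimately show "\<chi> \<in> vars (inst_fm \<sigma> \<phi>)"
      by blast
  qed
  from families_interpolant[OF \<open>distinct fs\<close> TV split vars_Q]
  obtain e C where "form L C" and form_e: "\<forall>x. form_mset L (e x)"
    and prems_e: "\<forall>x\<in>set fs. \<forall>(\<phi>s, \<psi>s)\<in>set (Q x). S x + \<phi>s \<turnstile> U x + e x + \<psi>s"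
    and join: "\<forall>\<Gamma> \<Delta>. \<Gamma> \<turnstile> (\<Sum>x\<leftarrow>fs. e x) + \<Delta> \<longrightarrow> \<Gamma> \<turnstile> add_mset C \<Delta>"
    and C: "add_mset C (\<Sum>x\<leftarrow>fs. T x) \<turnstile> (\<Sum>x\<leftarrow>fs. V x)"
    and vars_C: "vars C \<subseteq> (vars (inst_fm \<sigma> \<phi>) \<union> (\<Union>x\<in>set fs. vars_mset (S x + U x))) \<inter>
       (\<Union>x\<in>set fs. vars_mset (T x + V x))"
    and size_C: "b \<longrightarrow> fsize C \<le> (\<Sum>x\<leftarrow>fs. \<Sum>(\<phi>s, \<psi>s)\<leftarrow>Q x.
       n (S x + T x + \<phi>s, U x + V x + \<psi>s) + 3) + 1 + (if \<exists>x\<in>set fs. Q x = [] then 2 else 0)"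
    by (elim exE conjE) rule
  \<comment> \<open>The new contexts are \<open>S x\<close> on the left and \<open>U x + e x\<close>
    on the right; only the first halves of the given contexts remain.\<close>
  obtain \<rho> where \<rho>: "\<And>x. x \<in> set fs \<Longrightarrow> \<rho> (fst x) = S x"
      "\<And>x. x \<in> set fs \<Longrightarrow> \<rho> (fst (snd x)) = U x + e x"
      "range \<rho> \<subseteq> insert {#} (S ` set fs \<union> (\<lambda>x. U x + e x) ` set fs)"
    by (rule ex_context_assignment[OF dist, of S "\<lambda>x. U x + e x"]) (rule that)
  have form_\<rho>: "form_mset L (\<rho> m)" for m
  proof -
    have "\<rho> m \<in> insert {#} (S ` set fs \<union> (\<lambda>x. U x + e x) ` set fs)"
      using \<rho>(3) by blast
    then show ?thesis
      using forms form_e by auto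
  qed
  have "image_mset (inst_seq \<sigma> \<rho>) (sa_prems fs) =
      mset (concat (map (\<lambda>x. map (\<lambda>(\<phi>s, \<psi>s). (S x + \<phi>s, U x + e x + \<psi>s)) (Q x)) fs))"
    unfolding inst_seq_sa_prems Q_def using \<rho>(1,2)
    by (intro arg_cong[of _ _ "\<lambda>l. mset (concat l)"] map_cong) auto
  then have "\<forall>P\<in>#image_mset (inst_seq \<sigma> \<rho>) (sa_prems fs). P \<in> provable H"
    using prems_e by (auto simp: derivable_def)
  then have "inst_seq \<sigma> \<rho> (image_mset MFm A + left_ctx fs, image_mset MFm B + right_ctx fs) \<in> provable H"
    using closed[OF r \<sigma> form_\<rho>] by auto
  moreover have "map (\<lambda>x. \<rho> (fst x)) fs = map S fs"
    "map (\<lambda>x. \<rho> (fst (snd x))) fs = map (\<lambda>x. U x + e x) fs"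
    using \<rho>(1,2) by auto
  ultimately have "image_mset (inst_fm \<sigma>) A + \<Sigma> \<turnstile> image_mset (inst_fm \<sigma>) B + (\<Theta> + (\<Sum>x\<leftarrow>fs. e x))"
    using ST(2) UV(2) by (simp add: inst_seq_def derivable_def sum_list_addf)
  then have "image_mset (inst_fm \<sigma>) A + \<Sigma> \<turnstile> add_mset C (image_mset (inst_fm \<sigma>) B + \<Theta>)"
    by (intro join[rule_format]) (simp add: ac_simps)
  moreover have "vars_mset (image_mset (inst_fm \<sigma>) A + image_mset (inst_fm \<sigma>) B) = vars (inst_fm \<sigma> \<phi>)"
    using arg_cong[OF AB, of "\<lambda>X. vars_mset (image_mset (inst_fm \<sigma>) X)"] by simp
  ultimately have "interpolant L H (image_mset (inst_fm \<sigma>) A + \<Sigma>) \<Lambda> (image_mset (inst_fm \<sigma>) B + \<Theta>) \<Delta> C"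
    using \<open>form L C\<close> C vars_C ST(2,3) UV(2,3) by (auto simp: interpolant_def derivable_def)
  moreover have "b \<longrightarrow> fsize C \<le> (\<Sum>P\<in>#image_mset (inst_seq \<sigma> \<tau>) (sa_prems fs). n P + 3) + 3"
    using size_C unfolding size by (auto split: if_splits)
  ultimately show ?thesis
    by blast
qed

text \<open>If the principal formula lies in the second part, the exchanged split is interpolated
  and the result negated.\<close>

lemma semi_analytic_interpolable:
  assumes "r \<in> R" and sa: "left_semi_analytic r \<or> right_semi_analytic r"
    and inst: "rule_instance L r Ps S" and prems: "\<forall>P\<in>#Ps. split_interpolable b (n P) P"
  shows "split_interpolable b ((\<Sum>P\<in>#Ps. n P + 3) + 5) S"
  unfolding split_interpolable_def
proof (intro allI impI)
  fix \<Sigma> \<Lambda> \<Theta> \<Delta>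
  assume S: "S = (\<Sigma> + \<Lambda>, \<Theta> + \<Delta>)"
  obtain \<sigma> \<tau> where \<sigma>: "\<And>n. form L (\<sigma> n)" and \<tau>: "\<And>m. form_mset L (\<tau> m)"
      and Ps: "Ps = image_mset (inst_seq \<sigma> \<tau>) (fst r)" and S': "S = inst_seq \<sigma> \<tau> (snd r)"
    using inst by (auto simp: rule_instance_def)
  obtain fs \<phi> A B where cond: "sa_condition fs \<phi>" and AB: "A + B = {#\<phi>#}"
      "A = {#\<phi>#} \<and> B = {#} \<or> A = {#} \<and> B = {#\<phi>#}"
      and r: "r = (sa_prems fs, (image_mset MFm A + left_ctx fs, image_mset MFm B + right_ctx fs))"
    using sa
  proof
    assume "left_semi_analytic r"
    then obtain fs \<phi> where "sa_condition fs \<phi>"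
      "r = (sa_prems fs, (add_mset (MFm \<phi>) (left_ctx fs), right_ctx fs))"
      unfolding left_semi_analytic_def by blast
    then show ?thesis
      by (intro that[of fs \<phi> "{#\<phi>#}" "{#}"]) auto
  next
    assume "right_semi_analytic r"
    then obtain fs \<phi> where "sa_condition fs \<phi>"
      "r = (sa_prems fs, (left_ctx fs, add_mset (MFm \<phi>) (right_ctx fs)))"
      unfolding right_semi_analytic_def by blast
    then show ?thesis
      by (intro that[of fs \<phi> "{#}" "{#\<phi>#}"]) auto
  qed
  define A' B' where "A' = image_mset (inst_fm \<sigma>) A" and "B' = image_mset (inst_fm \<sigma>) B"
  define \<Gamma> \<Pi> where "\<Gamma> = (\<Sum>x\<leftarrow>fs. \<tau> (fst x))" and "\<Pi> = (\<Sum>x\<leftarrow>fs. \<tau> (fst (snd x)))"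
  have seq: "\<Sigma> + \<Lambda> = A' + \<Gamma>" "\<Theta> + \<Delta> = B' + \<Pi>"
    using S S' by (auto simp: r inst_seq_def A'_def B'_def \<Gamma>_def \<Pi>_def)
  note principal_first = semi_analytic_interpolant[where \<sigma> = \<sigma> and \<tau> = \<tau>, OF \<open>r \<in> R\<close>[unfolded r] cond AB(1) \<sigma> \<tau>,
      folded A'_def B'_def \<Gamma>_def \<Pi>_def, OF prems[unfolded Ps r fst_conv]]
  have Ps': "Ps = image_mset (inst_seq \<sigma> \<tau>) (sa_prems fs)"
    by (simp add: Ps r)
  \<comment> \<open>A single principal formula cannot be divided between the two parts.\<close>
  have "A' \<subseteq># \<Sigma> \<and> B' \<subseteq># \<Theta> \<or> A' \<subseteq># \<Lambda> \<and> B' \<subseteq># \<Delta>"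
    using AB(2)
  proof
    assume "A = {#\<phi>#} \<and> B = {#}"
    then have *: "A' = {#inst_fm \<sigma> \<phi>#}" "B' = {#}"
      by (auto simp: A'_def B'_def)
    then have "inst_fm \<sigma> \<phi> \<in># \<Sigma> + \<Lambda>"
      using seq by simp
    with * show ?thesis
      by auto
  next
    assume "A = {#} \<and> B = {#\<phi>#}"
    then have *: "A' = {#}" "B' = {#inst_fm \<sigma> \<phi>#}"
      by (auto simp: A'_def B'_def)
    then have "inst_fm \<sigma> \<phi> \<in># \<Theta> + \<Delta>"
      using seq by simp
    with * show ?thesis
      by auto
  qed
  then show "\<exists>C. interpolant L H \<Sigma> \<Lambda> \<Theta> \<Delta> C \<and> (b \<longrightarrow> fsize C \<le> (\<Sum>P\<in>#Ps. n P + 3) + 5)"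
  proof
    assume "A' \<subseteq># \<Sigma> \<and> B' \<subseteq># \<Theta>"
    then obtain \<Sigma>' \<Theta>' where *: "\<Sigma> = A' + \<Sigma>'" "\<Theta> = B' + \<Theta>'"
      by (auto simp: mset_subset_eq_exists_conv)
    with seq have "\<Gamma> = \<Sigma>' + \<Lambda>" "\<Pi> = \<Theta>' + \<Delta>"
      by (simp_all add: add.assoc)
    from principal_first[OF this] show ?thesis
      unfolding * Ps' by fastforce
  next
    assume "A' \<subseteq># \<Lambda> \<and> B' \<subseteq># \<Delta>"
    then obtain \<Lambda>' \<Delta>' where *: "\<Lambda> = A' + \<Lambda>'" "\<Delta> = B' + \<Delta>'"
      by (auto simp: mset_subset_eq_exists_conv)
    with seq have "A' + \<Gamma> = A' + (\<Lambda>' + \<Sigma>)" "B' + \<Pi> = B' + (\<Delta>' + \<Theta>)"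
      by (simp_all add: ac_simps)
    then have "\<Gamma> = \<Lambda>' + \<Sigma>" "\<Pi> = \<Delta>' + \<Theta>"
      by simp_all
    from principal_first[OF this] obtain C where "interpolant L H \<Lambda> \<Sigma> \<Delta> \<Theta> C"
      "b \<longrightarrow> fsize C \<le> (\<Sum>P\<in>#Ps. n P + 3) + 3"
      unfolding * Ps' by blast
    then show ?thesis
      by (intro exI[of _ "neg C"]) (auto intro: interpolant_swap)
  qed
qed

section \<open>Modal rules\<close>

text \<open>
  The map \<open>F\<close> produces the antecedent of the premise from \<open>\<Gamma>\<close>: it is \<open>\<Gamma>\<close> for K and D, \<open>\<box>\<Gamma>\<close> for RS4, and
  \<open>\<box>\<Gamma>, \<Gamma>\<close> for 4 and 4D. The succedent \<open>E\<close> of the premise has at most one formula.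
\<close>

lemma modal_interpolable:
  assumes F_add: "\<And>X Y. F (X + Y) = F X + F Y" and vars_F: "\<And>X. vars_mset (F X) = vars_mset X"
    and nec: "\<And>X A. form_mset L X \<Longrightarrow> form L A \<Longrightarrow> F X \<turnstile> {#A#} \<Longrightarrow> image_mset Box X \<turnstile> {#Box A#}"
    and nec_E: "\<And>X. form_mset L X \<Longrightarrow> F X \<turnstile> E \<Longrightarrow> image_mset Box X \<turnstile> image_mset Box E"
    and box: "\<And>C X \<Delta>. form_mset L X \<Longrightarrow> form L C \<Longrightarrow> add_mset C (F X) \<turnstile> \<Delta> \<Longrightarrow> F (add_mset C X) \<turnstile> \<Delta>"
    and "size E \<le> 1" and \<Gamma>: "form_mset L \<Gamma>" and "has_box L"
    and prem: "split_interpolable b n (F \<Gamma>, E)"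
  shows "split_interpolable b (n + 3) (image_mset Box \<Gamma>, image_mset Box E)"
proof -
  \<comment> \<open>The case of an empty first succedent. As \<open>E\<close> has at most one
    formula, every split is of this form or becomes so by exchange.\<close>
  have one_side: "\<exists>C. interpolant L H (image_mset Box \<Gamma>1) (image_mset Box \<Gamma>2) {#} (image_mset Box E) C \<and>
      (b \<longrightarrow> fsize C \<le> n + 1)" if \<Gamma>12: "\<Gamma> = \<Gamma>1 + \<Gamma>2" for \<Gamma>1 \<Gamma>2
  proof -
    have forms: "form_mset L \<Gamma>1" "form_mset L \<Gamma>2"
      using \<Gamma> \<Gamma>12 by auto
    obtain C where C: "form L C" "F \<Gamma>1 \<turnstile> {#C#}" "add_mset C (F \<Gamma>2) \<turnstile> E"
      "vars C \<subseteq> vars_mset (F \<Gamma>1 + {#}) \<inter> vars_mset (F \<Gamma>2 + E)" "b \<Longrightarrow> fsize C \<le> n"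
      using split_interpolableE[OF prem, of "F \<Gamma>1" "F \<Gamma>2" "{#}" E] \<Gamma>12 F_add by auto
    \<comment> \<open>This half has the succedent \<open>C\<close> even if \<open>E\<close> is
      empty; therefore D requires K, and 4D requires 4.\<close>
    have "image_mset Box \<Gamma>1 \<turnstile> {#Box C#}"
      using nec forms C by blast
    moreover have "image_mset Box (add_mset C \<Gamma>2) \<turnstile> image_mset Box E"
      using forms C by (intro nec_E box) auto
    ultimately show ?thesis
      using C(1,4,5) \<open>has_box L\<close>
      by (intro exI[of _ "Box C"]) (auto simp: interpolant_def derivable_def vars_F)
  qed
  show ?thesis
    unfolding split_interpolable_def
  proof (intro allI impI)
    fix \<Sigma> \<Lambda> \<Theta> \<Delta>
    assume "(image_mset Box \<Gamma>, image_mset Box E) = (\<Sigma> + \<Lambda>, \<Theta> + \<Delta>)"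
    then have eqs: "image_mset Box \<Gamma> = \<Sigma> + \<Lambda>" "image_mset Box E = \<Theta> + \<Delta>"
      by auto
    \<comment> \<open>All formulas on the left are boxed, so a split of the conclusion comes from a
      split of \<open>\<Gamma>\<close>.\<close>
    then obtain \<Gamma>1 \<Gamma>2 where \<Gamma>12: "\<Gamma> = \<Gamma>1 + \<Gamma>2" "\<Sigma> = image_mset Box \<Gamma>1" "\<Lambda> = image_mset Box \<Gamma>2"
      by (metis image_mset_eq_plusD)
    have "size \<Theta> + size \<Delta> \<le> 1"
      using \<open>size E \<le> 1\<close> eqs(2) by (metis size_image_mset size_union)
    then have "\<Theta> = {#} \<or> \<Delta> = {#}"
      by (cases \<Theta>; cases \<Delta>) auto
    then show "\<exists>C. interpolant L H \<Sigma> \<Lambda> \<Theta> \<Delta> C \<and> (b \<longrightarrow> fsize C \<le> n + 3)"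
    proof
      assume "\<Theta> = {#}"
      then show ?thesis
        using one_side[OF \<Gamma>12(1)] \<Gamma>12 eqs(2) by fastforce
    next
      assume "\<Delta> = {#}"
      then obtain C where "interpolant L H \<Lambda> \<Sigma> \<Delta> \<Theta> C" "b \<longrightarrow> fsize C \<le> n + 1"
        using one_side[of \<Gamma>2 \<Gamma>1] \<Gamma>12 eqs(2) by (auto simp: add.commute)
      then show ?thesis
        by (intro exI[of _ "neg C"]) (auto intro: interpolant_swap)
    qed
  qed
qed

lemma nec_K:
  assumes "\<exists>r\<in>R. is_K r" "form_mset L X" "form L A" "X \<turnstile> {#A#}"
  shows "image_mset Box X \<turnstile> {#Box A#}"
proof -
  obtain g p where "({#({#MVar g#}, {#mF p#})#}, ({#MBox g#}, {#MFm (Box (Atom (FVar p)))#})) \<in> R"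
    using assms(1) unfolding is_K_def by blast
  from closed[OF this, of "\<lambda>_. A" "\<lambda>_. X"] show ?thesis
    using assms by (simp add: inst_seq_def derivable_def)
qed

lemma nec_D:
  assumes "\<exists>r\<in>R. is_D r" "form_mset L X" "X \<turnstile> {#}"
  shows "image_mset Box X \<turnstile> {#}"
proof -
  obtain g where "({#({#MVar g#}, {#})#}, ({#MBox g#}, {#})) \<in> R"
    using assms(1) unfolding is_D_def by blast
  from closed[OF this, of "\<lambda>_. Zero" "\<lambda>_. X"] show ?thesis
    using assms by (simp add: inst_seq_def derivable_def)
qed

lemma nec_RS4:
  assumes "\<exists>r\<in>R. is_RS4 r" "form_mset L X" "form L A" "image_mset Box X \<turnstile> {#A#}"
  shows "image_mset Box X \<turnstile> {#Box A#}"
proof -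
  obtain g p where "({#({#MBox g#}, {#mF p#})#}, ({#MBox g#}, {#MFm (Box (Atom (FVar p)))#})) \<in> R"
    using assms(1) unfolding is_RS4_def by blast
  from closed[OF this, of "\<lambda>_. A" "\<lambda>_. X"] show ?thesis
    using assms by (simp add: inst_seq_def derivable_def)
qed

text \<open>RS4 needs a fully boxed antecedent, whereas the second half of its premise contains the
  interpolant unboxed.\<close>

lemma box_left_LS4:
  assumes "\<exists>r\<in>R. is_LS4 r" "add_mset A X \<turnstile> \<Delta>"
  shows "add_mset (Box A) X \<turnstile> \<Delta>"
proof -
  obtain g d p where "g \<noteq> d" and
    "({#({#MVar g, mF p#}, {#MVar d#})#}, ({#MVar g, MFm (Box (Atom (FVar p)))#}, {#MVar d#})) \<in> R"
    using assms(1) unfolding is_LS4_def by blast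
  from closed[OF this(2), of "\<lambda>_. A" "\<lambda>m. if m = g then X else \<Delta>"] this(1) show ?thesis
    using assms(2) form_derivable[OF assms(2)] by (auto simp: inst_seq_def derivable_def)
qed

lemma nec_4:
  assumes "\<exists>r\<in>R. is_4 r" "form_mset L X" "form L A" "image_mset Box X + X \<turnstile> {#A#}"
  shows "image_mset Box X \<turnstile> {#Box A#}"
proof -
  obtain g p where "({#({#MBox g, MVar g#}, {#mF p#})#}, ({#MBox g#}, {#MFm (Box (Atom (FVar p)))#})) \<in> R"
    using assms(1) unfolding is_4_def by blast
  from closed[OF this, of "\<lambda>_. A" "\<lambda>_. X"] show ?thesis
    using assms by (simp add: inst_seq_def derivable_def add.commute)
qed

lemma nec_4D:
  assumes "\<exists>r\<in>R. is_4D r" "form_mset L X" "image_mset Box X + X \<turnstile> {#}"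
  shows "image_mset Box X \<turnstile> {#}"
proof -
  obtain g where "({#({#MBox g, MVar g#}, {#})#}, ({#MBox g#}, {#})) \<in> R"
    using assms(1) unfolding is_4D_def by blast
  from closed[OF this, of "\<lambda>_. Zero" "\<lambda>_. X"] show ?thesis
    using assms by (simp add: inst_seq_def derivable_def add.commute)
qed

text \<open>One bound serves every rule: each premise enters once, with at most 3 further symbols,
  and 5 more are allowed per inference. LS4 needs no case of its own, being left
  semi-analytic.\<close>

lemma rule_interpolable:
  assumes "r \<in> R" and rules: "semi_analytic r \<or> is_4 r \<or> is_4D r"
    and "calculus L R" and prov: "modal_provisos R"
    and weak: "(\<exists>r\<in>R. is_4 r \<or> is_4D r) \<longrightarrow> box_weakening_admissible L H"
    and inst: "rule_instance L r Ps S" and prems: "\<forall>P\<in>#Ps. split_interpolable b (n P) P"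
  shows "split_interpolable b ((\<Sum>P\<in>#Ps. n P + 3) + 5) S"
proof -
  obtain \<sigma> \<tau> where \<sigma>: "\<And>n. form L (\<sigma> n)" and \<tau>: "\<And>m. form_mset L (\<tau> m)"
      and Ps: "Ps = image_mset (inst_seq \<sigma> \<tau>) (fst r)" and S: "S = inst_seq \<sigma> \<tau> (snd r)"
    using inst by (auto simp: rule_instance_def)
  have mono: "split_interpolable b k T \<Longrightarrow> k \<le> m \<Longrightarrow> split_interpolable b m T" for k m T
    unfolding split_interpolable_def using le_trans by blast
  have conc_ok: "mseq_ok L (snd r)"
    using \<open>calculus L R\<close> \<open>r \<in> R\<close> by (auto simp: calculus_def)
  \<comment> \<open>For 4 and 4D, enlarging \<open>X\<close> by \<open>C\<close> enlarges
    \<open>\<box>X, X\<close> by both \<open>C\<close> and \<open>\<box>C\<close>. The premise's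
    interpolant supplies only \<open>C\<close>; weakening adds \<open>\<box>C\<close>.\<close>
  have box_weak: "add_mset (Box C) X \<turnstile> \<Delta>"
    if "is_4 r \<or> is_4D r" "has_box L" "form L C" "X \<turnstile> \<Delta>" for C X \<Delta>
    using weak that \<open>r \<in> R\<close> by (auto simp: box_weakening_admissible_def derivable_def)
  consider "left_semi_analytic r \<or> right_semi_analytic r" | "is_K r" | "is_D r" | "is_RS4 r" | "is_4 r" | "is_4D r"
    using rules by (auto simp: semi_analytic_def)
  then show ?thesis
  proof cases
    case 1
    then show ?thesis
      using semi_analytic_interpolable[OF \<open>r \<in> R\<close> _ inst prems] by simp
  next
    case 2
    then obtain g p where r: "r = ({#({#MVar g#}, {#mF p#})#}, ({#MBox g#}, {#MFm (Box (Atom (FVar p)))#}))"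
      unfolding is_K_def by blast
    have K: "\<exists>r\<in>R. is_K r"
      using 2 \<open>r \<in> R\<close> by blast
    have "split_interpolable b (n (\<tau> g, {#\<sigma> p#}) + 3) (image_mset Box (\<tau> g), image_mset Box {#\<sigma> p#})"
      by (rule modal_interpolable[where F = "\<lambda>X. X"])
        (use conc_ok prems \<sigma> \<tau> form_derivable in \<open>auto simp: Ps r inst_seq_def mseq_ok_def intro: nec_K[OF K]\<close>)
    from mono[OF this] show ?thesis
      by (auto simp: Ps S r inst_seq_def)
  next
    case 3
    then obtain g where r: "r = ({#({#MVar g#}, {#})#}, ({#MBox g#}, {#}))"
      unfolding is_D_def by blast
    have D: "\<exists>r\<in>R. is_D r" and K: "\<exists>r\<in>R. is_K r"
      using 3 \<open>r \<in> R\<close> prov by (auto simp: modal_provisos_def)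
    have "split_interpolable b (n (\<tau> g, {#}) + 3) (image_mset Box (\<tau> g), image_mset Box {#})"
      by (rule modal_interpolable[where F = "\<lambda>X. X"])
        (use conc_ok prems \<tau> in \<open>auto simp: Ps r inst_seq_def mseq_ok_def intro: nec_K[OF K] nec_D[OF D]\<close>)
    from mono[OF this] show ?thesis
      by (auto simp: Ps S r inst_seq_def)
  next
    case 4
    then obtain g p where r: "r = ({#({#MBox g#}, {#mF p#})#}, ({#MBox g#}, {#MFm (Box (Atom (FVar p)))#}))"
      unfolding is_RS4_def by blast
    have RS4: "\<exists>r\<in>R. is_RS4 r" and LS4: "\<exists>r\<in>R. is_LS4 r"
      using 4 \<open>r \<in> R\<close> prov by (auto simp: modal_provisos_def)
    have "split_interpolable b (n (image_mset Box (\<tau> g), {#\<sigma> p#}) + 3)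
        (image_mset Box (\<tau> g), image_mset Box {#\<sigma> p#})"
      by (rule modal_interpolable[where F = "image_mset Box"])
        (use conc_ok prems \<sigma> \<tau> form_derivable in \<open>auto simp: Ps r inst_seq_def mseq_ok_def
          intro: nec_RS4[OF RS4] box_left_LS4[OF LS4]\<close>)
    from mono[OF this] show ?thesis
      by (auto simp: Ps S r inst_seq_def)
  next
    case 5
    then obtain g p where r: "r = ({#({#MBox g, MVar g#}, {#mF p#})#}, ({#MBox g#}, {#MFm (Box (Atom (FVar p)))#}))"
      unfolding is_4_def by blast
    have R4: "\<exists>r\<in>R. is_4 r"
      using 5 \<open>r \<in> R\<close> by blast
    have "split_interpolable b (n (image_mset Box (\<tau> g) + \<tau> g, {#\<sigma> p#}) + 3)
        (image_mset Box (\<tau> g), image_mset Box {#\<sigma> p#})"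
      by (rule modal_interpolable[where F = "\<lambda>X. image_mset Box X + X"])
        (use conc_ok prems \<sigma> \<tau> form_derivable 5 in \<open>auto simp: Ps r inst_seq_def mseq_ok_def ac_simps
          intro: nec_4[OF R4] box_weak\<close>)
    from mono[OF this] show ?thesis
      by (auto simp: Ps S r inst_seq_def add.commute)
  next
    case 6
    then obtain g where r: "r = ({#({#MBox g, MVar g#}, {#})#}, ({#MBox g#}, {#}))"
      unfolding is_4D_def by blast
    have R4: "\<exists>r\<in>R. is_4 r" and R4D: "\<exists>r\<in>R. is_4D r"
      using 6 \<open>r \<in> R\<close> prov by (auto simp: modal_provisos_def)
    have "split_interpolable b (n (image_mset Box (\<tau> g) + \<tau> g, {#}) + 3)
        (image_mset Box (\<tau> g), image_mset Box {#})"
      by (rule modal_interpolable[where F = "\<lambda>X. image_mset Box X + X"])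
        (use conc_ok prems \<tau> 6 in \<open>auto simp: Ps r inst_seq_def mseq_ok_def ac_simps
          intro: nec_4[OF R4] nec_4D[OF R4D] box_weak\<close>)
    from mono[OF this] show ?thesis
      by (auto simp: Ps S r inst_seq_def add.commute)
  qed
qed

end

section \<open>Polynomial bounds and the induction over proofs\<close>

text \<open>Superadditivity of \<open>x ^ e\<close> for positive \<open>e\<close> lets a polynomial
  bound on subproofs pass to the whole tree. With exponent 0 it fails for two summands.\<close>

lemma sum_list_power_le: "e \<noteq> 0 \<Longrightarrow> (\<Sum>x\<leftarrow>xs. f x ^ e) \<le> (\<Sum>x\<leftarrow>xs. f x :: nat) ^ e"
proof (induction xs)
  case (Cons x xs)
  obtain e' where e: "e = Suc e'"
    using Cons.prems by (cases e) auto
  have superadd: "a ^ e + c ^ e \<le> (a + c) ^ e" for a c :: nat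
    by (auto simp: e algebra_simps intro!: add_mono mult_left_mono power_mono)
  have "(\<Sum>x\<leftarrow>x # xs. f x ^ e) \<le> f x ^ e + (\<Sum>x\<leftarrow>xs. f x) ^ e"
    using Cons by simp
  also have "\<dots> \<le> (\<Sum>x\<leftarrow>x # xs. f x) ^ e"
    using superadd by simp
  finally show ?case .
qed auto

theorem theorem4p5:
  fixes L :: "'c lang"
    and G R :: "('a, 'c) rule set"
    and H :: "('a, 'c) ptree set"
  assumes "calculus L G" and "calculus L R"
    and "H = ax_ext L (proofs L G) R"
    and "extends_CFLe L H"
    and "\<forall>r\<in>R. semi_analytic r \<or> is_4 r \<or> is_4D r"
    and "modal_provisos R"
    and "(\<exists>r\<in>R. is_4 r \<or> is_4D r) \<longrightarrow> box_weakening_admissible L H"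
  shows "(strong_interpolation L (proofs L G) H \<longrightarrow> strong_interpolation L H H) \<and>
         (strong_feasible_interpolation L (proofs L G) H \<longrightarrow> strong_feasible_interpolation L H H)"
proof -
  have "form_seq L (concl \<pi>)" if "\<pi> \<in> proofs L G" for \<pi>
    using form_seq_ax_ext[OF assms(1), of "{}"] that by (auto simp: proofs_def)
  then have "form_seq L S" if "S \<in> provable H" for S
    using form_seq_ax_ext[OF assms(2)] that unfolding assms(3) provable_def by blast
  then interpret cfle_extension L H R
    using assms(3,4) provable_ax_ext_step[of _ R L _ _ "proofs L G"] by unfold_locales auto
  note step_interpolable = rule_interpolable[OF _ _ assms(2,6,7)]
  \<comment> \<open>With the flag off, the numbers impose nothing, so 0 serves throughout.\<close>
  have "split_interpolable False 0 (concl \<pi>)"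
    if "strong_interpolation L (proofs L G) H" "\<pi> \<in> H" for \<pi>
    using that(2)[unfolded assms(3)]
  proof induction
    case (base \<pi>)
    then show ?case
      using that(1) by (auto simp: strong_interpolation_def split_interpolable_def)
  next
    case (step r \<pi>s S)
    then have "split_interpolable False ((\<Sum>P\<in>#mset (map concl \<pi>s). 0 + 3) + 5) S"
      using assms(5) by (intro step_interpolable[where n = "\<lambda>_. 0"]) auto
    then show ?case
      by (simp add: split_interpolable_def)
  qed
  then have "strong_interpolation L H H" if "strong_interpolation L (proofs L G) H"
    using that by (force simp: strong_interpolation_def split_interpolable_def)
  moreover have "strong_feasible_interpolation L H H"
    if feas: "strong_feasible_interpolation L (proofs L G) H"
  proof -
    obtain k where k: "\<And>\<pi>. \<pi> \<in> proofs L G \<Longrightarrow> split_interpolable True (psize \<pi> ^ k + k) (concl \<pi>)"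
      using feas by (simp add: strong_feasible_interpolation_def split_interpolable_def) blast
    \<comment> \<open>\<open>e\<close> is at least \<open>k\<close>, for the axioms, and positive,
      for superadditivity. \<open>A\<close> covers \<open>k\<close> and also 8, the 5 symbols per
      inference plus the 3 held back in the invariant.\<close>
    define A e where "A = k + 8" and "e = Suc k"
    have psize_pos: "psize \<pi> \<ge> 1" for \<pi> :: "('a, 'c) ptree"
      by (cases \<pi>) (simp add: seq_size_def)
    have mono: "split_interpolable True m S \<Longrightarrow> m \<le> m' \<Longrightarrow> split_interpolable True m' S" for m m' S
      unfolding split_interpolable_def using le_trans by blast
    \<comment> \<open>The 3 subtracted here pays for the 3 that each premise costs in the next
      inference. Truncation does no harm, since \<open>A * psize \<pi> ^ e\<close> is at least
      8.\<close>
    have bound: "split_interpolable True (A * psize \<pi> ^ e - 3) (concl \<pi>)" if "\<pi> \<in> H" for \<pi>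
      using that[unfolded assms(3)]
    proof induction
      case (base \<pi>)
      have "psize \<pi> ^ k \<le> psize \<pi> ^ e" "1 \<le> psize \<pi> ^ e"
        using psize_pos[of \<pi>] by (auto simp: e_def)
      moreover from this have "(k + 7) * 1 \<le> (k + 7) * psize \<pi> ^ e"
        by (intro mult_left_mono) auto
      ultimately have "psize \<pi> ^ k + k \<le> A * psize \<pi> ^ e - 3"
        by (simp add: A_def add_mult_distrib)
      then show ?case
        using k[OF base] mono by blast
    next
      case (step r \<pi>s S)
      \<comment> \<open>Distinct subproofs may have equal conclusions; the least bound depends on the sequent only.\<close>
      define N where "N P = (LEAST m. split_interpolable True m P)" for P
      have N: "split_interpolable True (N (concl \<pi>)) (concl \<pi>) \<and> N (concl \<pi>) \<le> A * psize \<pi> ^ e - 3"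
        if "\<pi> \<in> set \<pi>s" for \<pi>
        using step.IH[OF that] unfolding N_def by (metis (mono_tags, lifting) LeastI Least_le)
      have "split_interpolable True ((\<Sum>P\<in>#mset (map concl \<pi>s). N P + 3) + 5) S"
        using assms(5) step.hyps N by (intro step_interpolable) auto
      moreover have "(\<Sum>P\<in>#mset (map concl \<pi>s). N P + 3) + 5 \<le> A * psize (Node S \<pi>s) ^ e - 3"
      proof -
        have "N (concl \<pi>) + 3 \<le> A * psize \<pi> ^ e" if "\<pi> \<in> set \<pi>s" for \<pi>
        proof -
          have "8 * 1 \<le> A * psize \<pi> ^ e"
            using psize_pos[of \<pi>] by (intro mult_mono) (auto simp: A_def)
          then show ?thesis
            using N[OF that] by linarith
        qed
        then have "(\<Sum>P\<in>#mset (map concl \<pi>s). N P + 3) \<le> (\<Sum>\<pi>\<leftarrow>\<pi>s. A * psize \<pi> ^ e)"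
          by (simp add: sum_mset_sum_list comp_def sum_list_mono flip: mset_map)
        also have "\<dots> = A * (\<Sum>\<pi>\<leftarrow>\<pi>s. psize \<pi> ^ e)"
          by (simp add: sum_list_const_mult)
        also have "\<dots> \<le> A * (\<Sum>\<pi>\<leftarrow>\<pi>s. psize \<pi>) ^ e"
          by (intro mult_left_mono sum_list_power_le) (auto simp: e_def)
        finally have "(\<Sum>P\<in>#mset (map concl \<pi>s). N P + 3) + 8 \<le> A * ((\<Sum>\<pi>\<leftarrow>\<pi>s. psize \<pi>) ^ e + 1 ^ e)"
          by (simp add: A_def)
        \<comment> \<open>The added 1 stands for the root sequent, whose size is at least 1; its
          share \<open>A * 1 ^ e\<close> has paid for the 8.\<close>
        also have "\<dots> \<le> A * ((\<Sum>\<pi>\<leftarrow>\<pi>s. psize \<pi>) + 1) ^ e"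
          using sum_list_power_le[of e "\<lambda>x. x" "[(\<Sum>\<pi>\<leftarrow>\<pi>s. psize \<pi>), 1]"]
          by (intro mult_left_mono) (auto simp: e_def)
        also have "\<dots> \<le> A * psize (Node S \<pi>s) ^ e"
          by (intro mult_left_mono power_mono) (auto simp: seq_size_def)
        finally show ?thesis
          by linarith
      qed
      ultimately show ?case
        using mono by simp
    qed
    \<comment> \<open>The definition asks for one number as both exponent and summand. For
      \<open>p\<close> at least 2 the factor \<open>A\<close> is below \<open>p ^ A\<close>; for
      \<open>p = 1\<close> the summand suffices.\<close>
    have "A * p ^ e - 3 \<le> p ^ (A + e) + (A + e)" if "p \<ge> 1" for p :: nat
    proof (cases "p = 1")
      case False
      have "A \<le> 2 ^ A"
        by (simp add: less_imp_le)
      also have "\<dots> \<le> p ^ A"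
        using that False by (intro power_mono) auto
      finally have "A * p ^ e \<le> p ^ (A + e)"
        by (simp add: power_add)
      then show ?thesis
        by linarith
    qed auto
    then have "split_interpolable True (psize \<pi> ^ (A + e) + (A + e)) (concl \<pi>)" if "\<pi> \<in> H" for \<pi>
      using bound[OF that] psize_pos mono by blast
    then show ?thesis
      unfolding strong_feasible_interpolation_def split_interpolable_def
      by (intro exI[of _ "A + e"]) force
  qed
  ultimately show ?thesis
    by blast
qed

end
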